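(* Let $G$ be a countable discrete group with a proper length function $l$, satisfying property $P$. Then the algebra $R^{\infty}(G)$ is a spectrally invariant dense subalgebra of the uniform Roe algebra $C_u^*(G)$.
   Context: A proper length function on $G$ is a function $l:G\to[0,\infty)$ with $l(x)=0$ iff $x=e$, $l(x^{-1})=l(x)$, $l(xy)\le l(x)+l(y)$, and $\{x\in G: l(x)\le r\}$ finite for all $r\ge 0$. It induces the left-invariant metric $\rho_l(x,y)=l(y^{-1}x)$. Write $B(x,r)=\{y\in G:\rho_l(x,y)<r\}$ and $|B(x,r)|$ for its cardinality. Property $P$: for any $\alpha>0$ and $0<\beta<1$ there exists a constant $C_{\alpha,\beta}$ such that $|B(x,r)|\le C_{\alpha,\beta}\exp(\alpha r^{\beta})$ for all $x\in G$ and $r>0$. Uniform Roe algebra: $C_u[G]$ is the $*$-algebra of matrices $T:G\times G\to\mathbb{C}$, $T=[t(x,y)]$, that are bounded ($\sup_{x,y}|t(x,y)|<\infty$) and have finite propagation (there is $R>0$ with $t(x,y)=0$ whenever $\rho_l(x,y)>R$), acting on $\ell^2(G)$ by $(T\xi)(x)=\sum_y t(x,y)\xi(y)$. $C_u^*(G)$ is the closure of $C_u[G]$ in the operator norm of $\mathcal{B}(\ell^2(G))$. For $\alpha>0$, $0<\beta<1$, $R_{\alpha,\beta}(G)$ is the set of matrices $T=(t(x,y))_{x,y\in G}:G\times G\to\mathbb{C}$ with $$\|T\|_{\alpha,\beta}=\Big[\sum_{z\in G}\Big(\sup_{x,y\in G,\,y^{-1}x=z}|t(x,y)|\Big)^2\exp\big(2\alpha\,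 l(z)^{\beta}\big)\Big]^{1/2}<\infty,$$ and $R^{\infty}(G)=\bigcup_{\alpha>0,\,0<\beta<1}R_{\alpha,\beta}(G)$, with matrix operations; matrices are identified with the operators on $\ell^2(G)$ they define. A subalgebra $\mathcal{A}$ of a unital algebra $\mathcal{B}$ with the same identity is spectrally invariant (inverse-closed) in $\mathcal{B}$ if $a\in\mathcal{A}$ and $a$ invertible in $\mathcal{B}$ imply $a^{-1}\in\mathcal{A}$. Dense means dense in the operator norm. *)

theory Defs
  imports "HOL-Analysis.Analysis"
begin

section \<open>Proper length functions and property P\<close>

text \<open>
  Groups are taken from the class \<^class>\<open>group_add\<close>, whose addition need not be commutative. Thus
  $xy$, $e$ and $x^{-1}$ are written \<open>x + y\<close>, \<open>0\<close> and \<open>- x\<close>, and $y^{-1}x$ is \<open>- y + x\<close>.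
\<close>

definition proper_length :: "('g::group_add \<Rightarrow> real) \<Rightarrow> bool" where
  "proper_length l \<longleftrightarrow>
     (\<forall>x. 0 \<le> l x) \<and>
     (\<forall>x. l x = 0 \<longleftrightarrow> x = 0) \<and>
     (\<forall>x. l (- x) = l x) \<and>
     (\<forall>x y. l (x + y) \<le> l x + l y) \<and>
     (\<forall>r\<ge>0. finite {x. l x \<le> r})"

definition length_dist :: "('g::group_add \<Rightarrow> real) \<Rightarrow> 'g \<Rightarrow> 'g \<Rightarrow> real" where
  "length_dist l x y = l (- y + x)"

definition length_ball :: "('g::group_add \<Rightarrow> real) \<Rightarrow> 'g \<Rightarrow> real \<Rightarrow> 'g set" where
  "length_ball l x r = {y. length_dist l x y < r}"

definition property_P :: "('g::group_add \<Rightarrow> real) \<Rightarrow> bool" where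
  "property_P l \<longleftrightarrow>
     (\<forall>\<alpha>>0. \<forall>\<beta>. 0 < \<beta> \<and> \<beta> < 1 \<longrightarrow>
        (\<exists>C. \<forall>x. \<forall>r>0. real (card (length_ball l x r)) \<le> C * exp (\<alpha> * r powr \<beta>)))"

section \<open>The Hilbert space of square-summable functions\<close>

typedef 'g ell2 = "{f :: 'g \<Rightarrow> complex. (\<lambda>x. (cmod (f x))\<^sup>2) summable_on UNIV}"
  morphisms ell2_apply Abs_ell2
  by (rule exI[of _ "\<lambda>_. 0"]) simp

setup_lifting type_definition_ell2

lemma square_summable_add_aux:
  fixes f g :: "'g \<Rightarrow> complex"
  assumes f: "(\<lambda>x. (cmod (f x))\<^sup>2) summable_on UNIV" and g: "(\<lambda>x. (cmod (g x))\<^sup>2) summable_on UNIV"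
  defines "F \<equiv> sqrt (\<Sum>\<^sub>\<infinity>x. (cmod (f x))\<^sup>2)" and "G \<equiv> sqrt (\<Sum>\<^sub>\<infinity>x. (cmod (g x))\<^sup>2)"
  shows "(\<lambda>x. (cmod (f x + g x))\<^sup>2) summable_on UNIV"
    and "sqrt (\<Sum>\<^sub>\<infinity>x. (cmod (f x + g x))\<^sup>2) \<le> F + G"
proof -
  have F0: "F \<ge> 0" "G \<ge> 0"
    by (auto simp: F_def G_def intro!: infsum_nonneg)
  have bound: "(\<Sum>x\<in>S. (cmod (f x + g x))\<^sup>2) \<le> (F + G)\<^sup>2" if "finite S" for S
  proof -
    have "L2_set (\<lambda>x. cmod (f x + g x)) S \<le> L2_set (\<lambda>x. cmod (f x) + cmod (g x)) S"
      by (intro L2_set_mono norm_triangle_ineq) auto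
    also have "\<dots> \<le> L2_set (\<lambda>x. cmod (f x)) S + L2_set (\<lambda>x. cmod (g x)) S"
      by (rule L2_set_triangle_ineq)
    also have "\<dots> \<le> F + G"
      unfolding L2_set_def F_def G_def using that f g
      by (intro add_mono real_sqrt_le_mono finite_sum_le_infsum) auto
    finally have "sqrt (\<Sum>x\<in>S. (cmod (f x + g x))\<^sup>2) \<le> F + G"
      by (simp add: L2_set_def)
    then show ?thesis
      by (rule sqrt_le_D)
  qed
  show s: "(\<lambda>x. (cmod (f x + g x))\<^sup>2) summable_on UNIV"
    by (rule nonneg_bdd_above_summable_on) (auto intro!: bdd_aboveI2 bound)
  have "(\<Sum>\<^sub>\<infinity>x. (cmod (f x + g x))\<^sup>2) \<le> (F + G)\<^sup>2"
    by (rule infsum_le_finite_sums[OF s]) (simp add: bound)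
  then show "sqrt (\<Sum>\<^sub>\<infinity>x. (cmod (f x + g x))\<^sup>2) \<le> F + G"
    using F0 by (simp add: real_le_lsqrt)
qed

lemma square_summable_mult_aux:
  fixes f :: "'g \<Rightarrow> complex"
  assumes "(\<lambda>x. (cmod (f x))\<^sup>2) summable_on UNIV"
  shows "(\<lambda>x. (cmod (c * f x))\<^sup>2) summable_on UNIV"
  using summable_on_cmult_right[OF assms, of "(cmod c)\<^sup>2"]
  by (simp add: norm_mult power_mult_distrib)

instantiation ell2 :: (type) real_normed_vector
begin

lift_definition zero_ell2 :: "'a ell2" is "\<lambda>_. 0" by simp

lift_definition uminus_ell2 :: "'a ell2 \<Rightarrow> 'a ell2" is "\<lambda>f x. - f x" by simp

lift_definition plus_ell2 :: "'a ell2 \<Rightarrow> 'a ell2 \<Rightarrow> 'a ell2" is "\<lambda>f g x. f x + g x"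
  by (rule square_summable_add_aux)

lift_definition minus_ell2 :: "'a ell2 \<Rightarrow> 'a ell2 \<Rightarrow> 'a ell2" is "\<lambda>f g x. f x - g x"
  subgoal for f g using square_summable_add_aux(1)[of f "\<lambda>x. - g x"] by simp
  done

lift_definition scaleR_ell2 :: "real \<Rightarrow> 'a ell2 \<Rightarrow> 'a ell2" is "\<lambda>r f x. of_real r * f x"
  by (rule square_summable_mult_aux)

lift_definition norm_ell2 :: "'a ell2 \<Rightarrow> real" is "\<lambda>f. sqrt (\<Sum>\<^sub>\<infinity>x. (cmod (f x))\<^sup>2)" .

definition sgn_ell2 :: "'a ell2 \<Rightarrow> 'a ell2" where
  "sgn_ell2 f = scaleR (inverse (norm f)) f"

definition dist_ell2 :: "'a ell2 \<Rightarrow> 'a ell2 \<Rightarrow> real" where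
  "dist_ell2 f g = norm (f - g)"

definition uniformity_ell2 :: "('a ell2 \<times> 'a ell2) filter" where
  "uniformity_ell2 = (INF e\<in>{0<..}. principal {(x, y). dist x y < e})"

definition open_ell2 :: "'a ell2 set \<Rightarrow> bool" where
  "open_ell2 U = (\<forall>x\<in>U. \<forall>\<^sub>F (x', y) in uniformity. x' = x \<longrightarrow> y \<in> U)"

instance
proof
  fix a b c :: "'a ell2" and r s :: real
  show "a + b + c = a + (b + c)" by transfer (simp add: add.assoc)
  show "a + b = b + a" by transfer (simp add: add.commute)
  show "0 + a = a" by transfer simp
  show "- a + a = 0" by transfer simp
  show "a - b = a + - b" by transfer simp
  show "r *\<^sub>R (a + b) = r *\<^sub>R a + r *\<^sub>R b" by transfer (simp add: algebra_simps)
  show "(r + s) *\<^sub>R a = r *\<^sub>R a + s *\<^sub>R a" by transfer (simp add: algebra_simps)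
  show "r *\<^sub>R s *\<^sub>R a = (r * s) *\<^sub>R a" by transfer (simp add: algebra_simps)
  show "1 *\<^sub>R a = a" by transfer simp
  show "dist a b = norm (a - b)" by (rule dist_ell2_def)
  show "sgn a = inverse (norm a) *\<^sub>R a" by (rule sgn_ell2_def)
  show "uniformity = (INF e\<in>{0<..}. principal {(x :: 'a ell2, y). dist x y < e})"
    by (rule uniformity_ell2_def)
  show "open U \<longleftrightarrow> (\<forall>x\<in>U. \<forall>\<^sub>F (x', y) in uniformity. x' = x \<longrightarrow> y \<in> U)" for U :: "'a ell2 set"
    by (rule open_ell2_def)
  show "norm a = 0 \<longleftrightarrow> a = 0"
  proof
    assume "norm a = 0"
    then show "a = 0"
    proof transfer
      fix f :: "'a \<Rightarrow> complex"
      assume f: "(\<lambda>x. (cmod (f x))\<^sup>2) summable_on UNIV" and "sqrt (\<Sum>\<^sub>\<infinity>x. (cmod (f x))\<^sup>2) = 0"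
      then have "(\<Sum>\<^sub>\<infinity>x. (cmod (f x))\<^sup>2) \<le> 0" by simp
      then have "(cmod (f x))\<^sup>2 = 0" for x
        by (rule nonneg_infsum_le_0D[OF _ f]) auto
      then show "f = (\<lambda>_. 0)" by auto
    qed
  qed (transfer, simp)
  show "norm (a + b) \<le> norm a + norm b"
    by transfer (rule square_summable_add_aux)
  show "norm (r *\<^sub>R a) = \<bar>r\<bar> * norm a"
    by transfer (simp add: norm_mult power_mult_distrib infsum_cmult_right' real_sqrt_mult)
qed

end

lift_definition ell2_scaleC :: "complex \<Rightarrow> 'g ell2 \<Rightarrow> 'g ell2" is "\<lambda>c f x. c * f x"
  by (rule square_summable_mult_aux)

lemma bounded_linear_ell2_scaleC: "bounded_linear (ell2_scaleC c)"
proof (rule bounded_linear_intro[where K = "cmod c"])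
  fix a b :: "'g ell2" and r :: real
  show "ell2_scaleC c (a + b) = ell2_scaleC c a + ell2_scaleC c b"
    by transfer (simp add: algebra_simps)
  show "ell2_scaleC c (r *\<^sub>R a) = r *\<^sub>R ell2_scaleC c a"
    by transfer (simp add: algebra_simps)
  show "norm (ell2_scaleC c a) \<le> norm a * cmod c"
    by transfer (simp add: norm_mult power_mult_distrib infsum_cmult_right' real_sqrt_mult)
qed

section \<open>Operators and matrices\<close>

text \<open>
  Bounded operators are elements of \<^typ>\<open>'g ell2 \<Rightarrow>\<^sub>L 'g ell2\<close> with its library norm (the operator norm)
  and topology. That type only requires real linearity; operators defined by matrices and their
  norm limits are automatically complex linear, so this does not affect any of the sets below.
\<close>

type_synonym 'g mat = "'g \<Rightarrow> 'g \<Rightarrow> complex"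
type_synonym 'g oper = "'g ell2 \<Rightarrow>\<^sub>L 'g ell2"

definition oper_scaleC :: "complex \<Rightarrow> 'g oper \<Rightarrow> 'g oper" where
  "oper_scaleC c A = Blinfun (\<lambda>\<xi>. ell2_scaleC c (blinfun_apply A \<xi>))"

lemma oper_scaleC_apply:
  "blinfun_apply (oper_scaleC c A) \<xi> = ell2_scaleC c (blinfun_apply A \<xi>)"
  unfolding oper_scaleC_def
  by (subst bounded_linear_Blinfun_apply)
    (auto intro: bounded_linear_compose[OF bounded_linear_ell2_scaleC] blinfun.bounded_linear_right)

definition mat_defines :: "'g mat \<Rightarrow> 'g oper \<Rightarrow> bool" where
  "mat_defines t A \<longleftrightarrow>
     (\<forall>\<xi> x. ((\<lambda>y. t x y * ell2_apply \<xi> y) has_sum ell2_apply (blinfun_apply A \<xi>) x) UNIV)"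

definition opers_of :: "'g mat set \<Rightarrow> 'g oper set" where
  "opers_of M = {A. \<exists>t\<in>M. mat_defines t A}"

definition unital_operator_algebra :: "'g oper set \<Rightarrow> bool" where
  "unital_operator_algebra \<A> \<longleftrightarrow>
     id_blinfun \<in> \<A> \<and>
     (\<forall>A\<in>\<A>. \<forall>B\<in>\<A>. A + B \<in> \<A>) \<and>
     (\<forall>c. \<forall>A\<in>\<A>. oper_scaleC c A \<in> \<A>) \<and>
     (\<forall>A\<in>\<A>. \<forall>B\<in>\<A>. A o\<^sub>L B \<in> \<A>)"

definition unital_subalgebra :: "'g oper set \<Rightarrow> 'g oper set \<Rightarrow> bool" where
  "unital_subalgebra \<A> \<B> \<longleftrightarrow>
     unital_operator_algebra \<A> \<and> unital_operator_algebra \<B> \<and> \<A> \<subseteq> \<B>"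

definition spectrally_invariant :: "'g oper set \<Rightarrow> 'g oper set \<Rightarrow> bool" where
  "spectrally_invariant \<A> \<B> \<longleftrightarrow>
     (\<forall>A\<in>\<A>. \<forall>B\<in>\<B>. A o\<^sub>L B = id_blinfun \<and> B o\<^sub>L A = id_blinfun \<longrightarrow> B \<in> \<A>)"

section \<open>The uniform Roe algebra and the rapid decay algebra\<close>

definition finite_propagation :: "('g::group_add \<Rightarrow> real) \<Rightarrow> 'g mat \<Rightarrow> bool" where
  "finite_propagation l t \<longleftrightarrow> (\<exists>R>0. \<forall>x y. length_dist l x y > R \<longrightarrow> t x y = 0)"

definition algebraic_Roe :: "('g::group_add \<Rightarrow> real) \<Rightarrow> 'g mat set" where
  "algebraic_Roe l = {t. (\<exists>M. \<forall>x y. cmod (t x y) \<le> M) \<and> finite_propagation l t}"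

definition uniform_Roe :: "('g::group_add \<Rightarrow> real) \<Rightarrow> 'g oper set" where
  "uniform_Roe l = closure (opers_of (algebraic_Roe l))"

text \<open>The square of the weighted norm, with value \<open>\<infinity>\<close> if a supremum or the sum diverges.\<close>

definition R_norm_sq :: "('g::group_add \<Rightarrow> real) \<Rightarrow> real \<Rightarrow> real \<Rightarrow> 'g mat \<Rightarrow> ennreal" where
  "R_norm_sq l \<alpha> \<beta> t =
     (\<Sum>\<^sub>\<infinity>z. (SUP (x, y)\<in>{(x, y). - y + x = z}. ennreal (cmod (t x y)))\<^sup>2
             * ennreal (exp (2 * \<alpha> * l z powr \<beta>)))"

definition R_space :: "('g::group_add \<Rightarrow> real) \<Rightarrow> real \<Rightarrow> real \<Rightarrow> 'g mat set" where
  "R_space l \<alpha> \<beta> = {t. R_norm_sq l \<alpha> \<beta> t < \<infinity>}"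

definition R_infinity :: "('g::group_add \<Rightarrow> real) \<Rightarrow> 'g mat set" where
  "R_infinity l = (\<Union>\<alpha>\<in>{0<..}. \<Union>\<beta>\<in>{0<..<1}. R_space l \<alpha> \<beta>)"

end

theory Submission
  imports Defs "HOL-Real_Asymp.Real_Asymp"
begin

text \<open>
  By property \<open>P\<close> every weight $\exp(-\alpha\, l^\beta)$ is summable over the group, so up to a
  change of $\alpha$ the weighted $\ell^2$ condition is the pointwise bound
  $|t(x,y)| \le C \exp(-\alpha\, l(y^{-1}x)^\beta)$. Products preserve such bounds because
  $l^\beta$ is subadditive, and truncations in propagation converge in norm by the estimate
  $\|T\| \le \sum_z \sup_{y^{-1}x=z} |t(x,y)|$.

  For spectral invariance, let $B = A^{-1}$ and conjugate $A$ by the multiplication operator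
  $D = \exp(\epsilon \varphi)$, where $\varphi$ is a bounded truncation of
  $x \mapsto l(q^{-1}x)^\beta$. As $|\varphi(x) - \varphi(y)| \le l(y^{-1}x)^\beta$, the difference
  $D A D^{-1} - A$ is small for small $\epsilon$, uniformly in the base point and the truncation.
  Hence $D B D^{-1}$, the inverse of $D A D^{-1}$, has norm at most $2\|B\|$, which makes the entries
  $B(x,q)$ decay like $\exp(-\epsilon\, l(q^{-1}x)^\beta)$.
\<close>

section \<open>Operators and their matrix entries\<close>

lemma ell2_apply_add: "ell2_apply (\<xi> + \<eta>) x = ell2_apply \<xi> x + ell2_apply \<eta> x"
  by transfer simp

lemma ell2_apply_diff: "ell2_apply (\<xi> - \<eta>) x = ell2_apply \<xi> x - ell2_apply \<eta> x"
  by transfer simp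

lemma ell2_apply_zero: "ell2_apply 0 x = 0"
  by transfer simp

lemma ell2_apply_scaleR: "ell2_apply (r *\<^sub>R \<xi>) x = of_real r * ell2_apply \<xi> x"
  by transfer simp

lemma ell2_apply_scaleC: "ell2_apply (ell2_scaleC c \<xi>) x = c * ell2_apply \<xi> x"
  by transfer simp

lemma ell2_apply_sum: "ell2_apply (sum f F) x = (\<Sum>y\<in>F. ell2_apply (f y) x)"
  by (induction F rule: infinite_finite_induct) (auto simp: ell2_apply_zero ell2_apply_add)

lemma ell2_eqI: "(\<And>x. ell2_apply \<xi> x = ell2_apply \<eta> x) \<Longrightarrow> \<xi> = \<eta>"
  by (metis ell2_apply_inject ext)

lemma ell2_apply_summable: "(\<lambda>x. (cmod (ell2_apply \<xi> x))\<^sup>2) summable_on UNIV"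
  using ell2_apply by auto

lemma norm_ell2_sq: "(norm \<xi>)\<^sup>2 = (\<Sum>\<^sub>\<infinity>x. (cmod (ell2_apply \<xi> x))\<^sup>2)"
  by transfer (simp add: infsum_nonneg)

lemma cmod_ell2_apply_le: "cmod (ell2_apply \<xi> x) \<le> norm \<xi>"
proof -
  have "(\<Sum>y\<in>{x}. (cmod (ell2_apply \<xi> y))\<^sup>2) \<le> (\<Sum>\<^sub>\<infinity>y. (cmod (ell2_apply \<xi> y))\<^sup>2)"
    by (rule finite_sum_le_infsum) (auto simp: ell2_apply_summable)
  then have "(cmod (ell2_apply \<xi> x))\<^sup>2 \<le> (norm \<xi>)\<^sup>2"
    by (simp add: norm_ell2_sq)
  then show ?thesis
    by (simp add: abs_le_square_iff[symmetric])
qed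

lemma bounded_linear_ell2_apply: "bounded_linear (\<lambda>\<xi>. ell2_apply \<xi> x)"
  by (rule bounded_linear_intro[where K = 1])
    (auto simp: ell2_apply_add ell2_apply_scaleR scaleR_conv_of_real cmod_ell2_apply_le)

lift_definition ell2_delta :: "'g \<Rightarrow> 'g ell2" is "\<lambda>y x. if x = y then 1 else 0"
  subgoal for y
    by (rule has_sum_imp_summable, rule has_sum_finite_neutralI[where B = "{y}"]) auto
  done

lemma ell2_apply_delta: "ell2_apply (ell2_delta y) x = (if x = y then 1 else 0)"
  by transfer simp

lemma norm_ell2_delta: "norm (ell2_delta y) = 1"
proof -
  have "(\<Sum>\<^sub>\<infinity>x. (cmod (ell2_apply (ell2_delta y) x))\<^sup>2) = 1"
    by (rule infsumI, rule has_sum_finite_neutralI[of "{y}"]) (auto simp: ell2_apply_delta)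
  then show ?thesis
    using norm_ell2_sq[of "ell2_delta y"] by (metis norm_ge_zero one_power2 power2_eq_iff_nonneg zero_le_one)
qed

text \<open>The squared error of the partial sum over a finite set \<open>F\<close> is the mass of
  \<open>\<xi>\<close> outside \<open>F\<close>, a tail of a convergent sum, and so tends to
  0.\<close>

lemma ell2_delta_expansion:
  "((\<lambda>y. ell2_scaleC (ell2_apply \<xi> y) (ell2_delta y)) has_sum \<xi>) UNIV"
proof -
  let ?a = "\<lambda>x. (cmod (ell2_apply \<xi> x))\<^sup>2"
  let ?s = "\<lambda>F. \<Sum>y\<in>F. ell2_scaleC (ell2_apply \<xi> y) (ell2_delta y)"
  have s: "?a summable_on A" for A
    by (rule summable_on_subset_banach[OF ell2_apply_summable]) simp
  have "(norm (?s F - \<xi>))\<^sup>2 = infsum ?a UNIV - sum ?a F" if "finite F" for F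
  proof -
    have "ell2_apply (?s F) x = (if x \<in> F then ell2_apply \<xi> x else 0)" for x
      using that by (simp add: ell2_apply_sum ell2_apply_scaleC ell2_apply_delta if_distrib cong: if_cong)
    then have "(norm (?s F - \<xi>))\<^sup>2 = (\<Sum>\<^sub>\<infinity>x. if x \<in> F then 0 else ?a x)"
      unfolding norm_ell2_sq by (intro infsum_cong) (auto simp: ell2_apply_diff)
    also have "\<dots> = infsum ?a (- F)"
      by (rule infsum_cong_neutral) auto
    also have "infsum ?a UNIV = infsum ?a F + infsum ?a (- F)"
      using infsum_Un_disjoint[OF s s, of F "- F"] by simp
    ultimately show ?thesis
      using that by simp
  qed
  moreover have "((\<lambda>F. infsum ?a UNIV - sum ?a F) \<longlongrightarrow> infsum ?a UNIV - infsum ?a UNIV)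
      (finite_subsets_at_top UNIV)"
    by (intro tendsto_diff tendsto_const infsum_tendsto s)
  ultimately have "((\<lambda>F. (norm (?s F - \<xi>))\<^sup>2) \<longlongrightarrow> 0) (finite_subsets_at_top UNIV)"
    by (subst tendsto_cong[where g = "\<lambda>F. infsum ?a UNIV - sum ?a F"])
      (auto intro: eventually_finite_subsets_at_top_weakI)
  from tendsto_real_sqrt[OF this] have "((\<lambda>F. norm (?s F - \<xi>)) \<longlongrightarrow> 0) (finite_subsets_at_top UNIV)"
    by simp
  then show ?thesis
    unfolding has_sum_def by (subst Lim_null) (rule tendsto_norm_zero_cancel)
qed

text \<open>Supplies the product of \<open>\<xi>\<close> with a bounded weight as a vector, without
  setting up a multiplication operator. The conjugating weight of the inverse argument enters this
  way.\<close>

lemma ell2_bounded_multiple: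
  fixes d :: "'g \<Rightarrow> complex"
  assumes "\<And>x. cmod (d x) \<le> M"
  obtains \<zeta> where "\<And>x. ell2_apply \<zeta> x = d x * ell2_apply \<xi> x"
proof -
  have "(\<lambda>x. (cmod (d x * ell2_apply \<xi> x))\<^sup>2) summable_on UNIV"
  proof (rule summable_on_comparison_test)
    show "(\<lambda>x. M\<^sup>2 * (cmod (ell2_apply \<xi> x))\<^sup>2) summable_on UNIV"
      by (intro summable_on_cmult_right ell2_apply_summable)
    show "(cmod (d x * ell2_apply \<xi> x))\<^sup>2 \<le> M\<^sup>2 * (cmod (ell2_apply \<xi> x))\<^sup>2" for x
      by (auto simp: norm_mult power_mult_distrib intro!: mult_right_mono power_mono assms)
  qed auto
  then show ?thesis
    using that[of "Abs_ell2 (\<lambda>x. d x * ell2_apply \<xi> x)"] by (simp add: Abs_ell2_inverse)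
qed

text \<open>Elements of \<open>'g oper\<close> are only real linear, and a real linear operator is
  not determined by its values on the vectors \<open>ell2_delta y\<close>. With this condition the
  entries determine the operator.\<close>

definition complex_linear :: "'g oper \<Rightarrow> bool" where
  "complex_linear A \<longleftrightarrow> (\<forall>c \<xi>. A (ell2_scaleC c \<xi>) = ell2_scaleC c (A \<xi>))"

definition entry :: "'g oper \<Rightarrow> 'g mat" where
  "entry A x y = ell2_apply (A (ell2_delta y)) x"

text \<open>For the converse direction, a coordinate of \<open>A \<xi>\<close> depends continuously
  on \<open>\<xi>\<close>, so \<open>A\<close> may be applied term by term to the delta expansion,
  and complex linearity moves the coefficients through \<open>A\<close>. Membership in
  \<open>opers_of\<close> thereby becomes a condition on \<open>entry A\<close>.\<close>

lemma mat_defines_iff: "mat_defines t A \<longleftrightarrow> complex_linear A \<and> t = entry A"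
proof
  assume t: "mat_defines t A"
  have "complex_linear A"
    unfolding complex_linear_def
  proof (intro allI ell2_eqI)
    fix c \<xi> x
    have "((\<lambda>y. t x y * ell2_apply \<xi> y) has_sum ell2_apply (A \<xi>) x) UNIV"
      using t by (simp add: mat_defines_def)
    from has_sum_cmult_right[OF this, of c]
    have "((\<lambda>y. t x y * ell2_apply (ell2_scaleC c \<xi>) y) has_sum c * ell2_apply (A \<xi>) x) UNIV"
      by (simp add: ell2_apply_scaleC mult.left_commute)
    with t show "ell2_apply (A (ell2_scaleC c \<xi>)) x = ell2_apply (ell2_scaleC c (A \<xi>)) x"
      unfolding mat_defines_def ell2_apply_scaleC[of c "A \<xi>"] by (meson has_sum_unique)
  qed
  moreover have "t x y = entry A x y" for x y
  proof -
    have "((\<lambda>z. t x z * ell2_apply (ell2_delta y) z) has_sum t x y) UNIV"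
      by (rule has_sum_finite_neutralI[of "{y}"]) (auto simp: ell2_apply_delta)
    with t show ?thesis
      unfolding mat_defines_def entry_def by (meson has_sum_unique)
  qed
  ultimately show "complex_linear A \<and> t = entry A" by blast
next
  assume *: "complex_linear A \<and> t = entry A"
  show "mat_defines t A"
    unfolding mat_defines_def
  proof (intro allI)
    fix \<xi> x
    have "bounded_linear (\<lambda>\<xi>. ell2_apply (A \<xi>) x)"
      by (intro bounded_linear_compose[OF bounded_linear_ell2_apply] blinfun.bounded_linear_right)
    from has_sum_bounded_linear[OF this ell2_delta_expansion[of \<xi>]]
    show "((\<lambda>y. t x y * ell2_apply \<xi> y) has_sum ell2_apply (A \<xi>) x) UNIV"
      using * by (simp add: complex_linear_def entry_def ell2_apply_scaleC mult.commute)
  qed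
qed

lemma mem_opers_of_iff: "A \<in> opers_of M \<longleftrightarrow> complex_linear A \<and> entry A \<in> M"
  by (auto simp: opers_of_def mat_defines_iff)

lemma cmod_entry_le: "cmod (entry A x y) \<le> norm A"
  using cmod_ell2_apply_le[of "A (ell2_delta y)" x] norm_blinfun[of A "ell2_delta y"]
  by (simp add: entry_def norm_ell2_delta)

lemma entry_id: "entry id_blinfun x y = (if x = y then 1 else 0)"
  by (simp add: entry_def ell2_apply_delta)

lemma entry_add: "entry (A + B) x y = entry A x y + entry B x y"
  by (simp add: entry_def blinfun.add_left ell2_apply_add)

lemma entry_diff: "entry (A - B) x y = entry A x y - entry B x y"
  by (simp add: entry_def blinfun.diff_left ell2_apply_diff)

lemma entry_scaleC: "entry (oper_scaleC c A) x y = c * entry A x y"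
  by (simp add: entry_def oper_scaleC_apply ell2_apply_scaleC)

lemma entry_compose:
  assumes "complex_linear A"
  shows "((\<lambda>y. entry A x y * entry B y w) has_sum entry (A o\<^sub>L B) x w) UNIV"
proof -
  have "mat_defines (entry A) A"
    using assms by (simp add: mat_defines_iff)
  then show ?thesis
    unfolding mat_defines_def entry_def[of B] entry_def[of "A o\<^sub>L B"] by simp
qed

lemma complex_linear_id: "complex_linear id_blinfun"
  by (simp add: complex_linear_def)

lemma complex_linear_add: "complex_linear A \<Longrightarrow> complex_linear B \<Longrightarrow> complex_linear (A + B)"
  by (auto simp: complex_linear_def blinfun.add_left ell2_apply_add ell2_apply_scaleC
      distrib_left intro!: ell2_eqI)

lemma complex_linear_diff: "complex_linear A \<Longrightarrow> complex_linear B \<Longrightarrow> complex_linear (A - B)"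
  by (auto simp: complex_linear_def blinfun.diff_left ell2_apply_diff ell2_apply_scaleC
      right_diff_distrib intro!: ell2_eqI)

lemma complex_linear_scaleC: "complex_linear A \<Longrightarrow> complex_linear (oper_scaleC c A)"
  by (auto simp: complex_linear_def oper_scaleC_apply ell2_apply_scaleC intro!: ell2_eqI)

lemma complex_linear_compose: "complex_linear A \<Longrightarrow> complex_linear B \<Longrightarrow> complex_linear (A o\<^sub>L B)"
  by (simp add: complex_linear_def)

section \<open>Algebras of operators and their norm closures\<close>

lemma unital_operator_algebra_opers_of:
  assumes "entry id_blinfun \<in> M"
    and "\<And>A B. entry A \<in> M \<Longrightarrow> entry B \<in> M \<Longrightarrow> entry (A + B) \<in> M"
    and "\<And>c A. entry A \<in> M \<Longrightarrow> entry (oper_scaleC c A) \<in> M"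
    and "\<And>A B. complex_linear A \<Longrightarrow> entry A \<in> M \<Longrightarrow> entry B \<in> M \<Longrightarrow> entry (A o\<^sub>L B) \<in> M"
  shows "unital_operator_algebra (opers_of M)"
  unfolding unital_operator_algebra_def
  by (auto simp: mem_opers_of_iff intro: assms complex_linear_id complex_linear_add complex_linear_scaleC
      complex_linear_compose)

lemma bounded_linear_oper_scaleC: "bounded_linear (oper_scaleC c :: 'g oper \<Rightarrow> 'g oper)"
proof (rule bounded_linear_intro[where K = "cmod c"])
  show "oper_scaleC c (A + B) = oper_scaleC c A + oper_scaleC c B" for A B :: "'g oper"
    by (intro blinfun_eqI ell2_eqI)
      (simp add: oper_scaleC_apply blinfun.add_left ell2_apply_add ell2_apply_scaleC distrib_left)
  show "oper_scaleC c (r *\<^sub>R A) = r *\<^sub>R oper_scaleC c A" for r and A :: "'g oper"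
    by (intro blinfun_eqI ell2_eqI)
      (simp add: oper_scaleC_apply blinfun.scaleR_left ell2_apply_scaleR ell2_apply_scaleC)
  show "norm (oper_scaleC c A) \<le> norm A * cmod c" for A :: "'g oper"
  proof (rule norm_blinfun_bound)
    fix \<xi> :: "'g ell2"
    have "norm (oper_scaleC c A \<xi>) = cmod c * norm (A \<xi>)"
      unfolding oper_scaleC_apply
      by transfer (simp add: norm_mult power_mult_distrib infsum_cmult_right' real_sqrt_mult)
    also have "\<dots> \<le> cmod c * (norm A * norm \<xi>)"
      by (intro mult_left_mono norm_blinfun) auto
    finally show "norm (oper_scaleC c A \<xi>) \<le> norm A * cmod c * norm \<xi>"
      by (simp add: ac_simps)
  qed auto
qed

text \<open>Elements of the closure are limits of sequences, and all the operations are continuous,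
  composition being bounded bilinear.\<close>

lemma unital_operator_algebra_closure:
  assumes "unital_operator_algebra \<A>"
  shows "unital_operator_algebra (closure \<A>)"
proof -
  note * = assms[unfolded unital_operator_algebra_def]
  have add: "A + B \<in> closure \<A>" if AB: "A \<in> closure \<A>" "B \<in> closure \<A>" for A B
  proof -
    obtain a b where ab: "\<And>n. a n \<in> \<A>" "a \<longlonglongrightarrow> A" "\<And>n. b n \<in> \<A>" "b \<longlonglongrightarrow> B"
      using AB unfolding closure_sequential by blast
    then show ?thesis
      unfolding closure_sequential using *
      by (intro exI[of _ "\<lambda>n. a n + b n"]) (auto intro: tendsto_add)
  qed
  have mult: "A o\<^sub>L B \<in> closure \<A>" if AB: "A \<in> closure \<A>" "B \<in> closure \<A>" for A B
  proof -
    obtain a b where ab: "\<And>n. a n \<in> \<A>" "a \<longlonglongrightarrow> A" "\<And>n. b n \<in> \<A>" "b \<longlonglongrightarrow> B"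
      using AB unfolding closure_sequential by blast
    then show ?thesis
      unfolding closure_sequential using *
      by (intro exI[of _ "\<lambda>n. a n o\<^sub>L b n"])
        (auto intro: bounded_bilinear.tendsto[OF bounded_bilinear_blinfun_compose])
  qed
  have scale: "oper_scaleC c A \<in> closure \<A>" if A: "A \<in> closure \<A>" for c A
  proof -
    obtain a where a: "\<And>n. a n \<in> \<A>" "a \<longlonglongrightarrow> A"
      using A unfolding closure_sequential by blast
    then show ?thesis
      unfolding closure_sequential using *
      by (intro exI[of _ "\<lambda>n. oper_scaleC c (a n)"])
        (auto intro: bounded_linear.tendsto[OF bounded_linear_oper_scaleC])
  qed
  show ?thesis
    using * closure_subset[of \<A>] add mult scale by (auto simp: unital_operator_algebra_def)
qed

section \<open>Matrices dominated by a convolution kernel\<close>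

lemma bij_left_quotient: "bij (\<lambda>y. - y + x)" "bij (\<lambda>x. - y + x)" for x y :: "'g::group_add"
proof -
  show "bij (\<lambda>y. - y + x)"
    by (rule o_bij[of "\<lambda>z. x - z"]) (auto simp: fun_eq_iff diff_add_eq_diff_diff_swap)
  show "bij (\<lambda>x. - y + x)"
    by (rule o_bij[of "\<lambda>z. y + z"]) (auto simp: fun_eq_iff)
qed

text \<open>Both maps are bijections of the group, so every row and every column of the kernel
  \<open>\<tau> (- y + x)\<close> has the same sum as \<open>\<tau>\<close>.\<close>

lemma has_sum_left_quotient:
  fixes f :: "'g::group_add \<Rightarrow> real"
  assumes "(f has_sum K) UNIV"
  shows "((\<lambda>y. f (- y + x)) has_sum K) UNIV" "((\<lambda>x. f (- y + x)) has_sum K) UNIV"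
  using assms has_sum_reindex_bij_betw[OF bij_left_quotient(1)[of x], of f K]
    has_sum_reindex_bij_betw[OF bij_left_quotient(2)[of y], of f K] by auto

lemma has_sum_finite_sum:
  fixes f :: "'a \<Rightarrow> 'b \<Rightarrow> 'c::topological_comm_monoid_add"
  assumes "\<And>x. x \<in> F \<Longrightarrow> (f x has_sum s x) A"
  shows "((\<lambda>y. \<Sum>x\<in>F. f x y) has_sum (\<Sum>x\<in>F. s x)) A"
  using assms by (induction F rule: infinite_finite_induct) (auto intro: has_sum_add)

text \<open>This is the Schur test. Row sums and Cauchy-Schwarz bound the square of
  \<open>cmod (h x)\<close> by \<open>K * q x\<close>; column sums then bound the sum of
  \<open>q\<close> by \<open>K\<close> times the squared norm of \<open>\<xi>\<close>.\<close>

lemma convolution_estimate: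
  fixes \<tau> :: "'g::group_add \<Rightarrow> real"
  assumes \<tau>: "(\<tau> has_sum K) UNIV" and t: "\<And>x y. cmod (t x y) \<le> \<tau> (- y + x)"
  shows "\<exists>\<eta>. (\<forall>x. ((\<lambda>y. t x y * ell2_apply \<xi> y) has_sum ell2_apply \<eta> x) UNIV) \<and>
    norm \<eta> \<le> K * norm \<xi>"
proof -
  define a where "a y = cmod (ell2_apply \<xi> y)" for y
  define q where "q x = (\<Sum>\<^sub>\<infinity>y. \<tau> (- y + x) * (a y)\<^sup>2)" for x
  define h where "h x = (\<Sum>\<^sub>\<infinity>y. t x y * ell2_apply \<xi> y)" for x
  have \<tau>0: "0 \<le> \<tau> z" for z
    using order_trans[OF norm_ge_zero t[of z 0]] by simp
  have K0: "0 \<le> K"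
    using has_sum_nonneg[OF \<tau>] \<tau>0 by auto
  have a0: "0 \<le> a y" and a1: "a y \<le> norm \<xi>" for y
    by (auto simp: a_def cmod_ell2_apply_le)
  have a_sum: "((\<lambda>y. (a y)\<^sup>2) has_sum (norm \<xi>)\<^sup>2) UNIV"
    unfolding norm_ell2_sq a_def by (intro has_sum_infsum ell2_apply_summable)
  have "(\<lambda>y. \<tau> (- y + x) * (a y)\<^sup>2) summable_on UNIV" for x
  proof (rule summable_on_comparison_test)
    show "(\<lambda>y. \<tau> (- y + x) * (norm \<xi>)\<^sup>2) summable_on UNIV"
      by (intro summable_on_cmult_left has_sum_imp_summable[OF has_sum_left_quotient(1)[OF \<tau>]])
  qed (auto intro!: mult_left_mono power_mono mult_nonneg_nonneg simp: \<tau>0 a0 a1)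
  then have q: "((\<lambda>y. \<tau> (- y + x) * (a y)\<^sup>2) has_sum q x) UNIV" for x
    by (simp add: q_def)
  have q0: "0 \<le> q x" for x
    unfolding q_def by (intro infsum_nonneg) (simp add: \<tau>0)
  have fin: "(\<Sum>y\<in>F. cmod (t x y * ell2_apply \<xi> y)) \<le> sqrt (K * q x)" if "finite F" for F x
  proof -
    have "(\<Sum>y\<in>F. cmod (t x y * ell2_apply \<xi> y)) \<le> (\<Sum>y\<in>F. \<tau> (- y + x) * a y)"
      by (intro sum_mono) (auto simp: norm_mult a_def intro!: mult_right_mono t)
    \<comment> \<open>Splitting the kernel into two square roots lets Cauchy-Schwarz put one of them
      into the row sum and the other into \<open>q x\<close>.\<close>
    also have "\<dots> = (\<Sum>y\<in>F. sqrt (\<tau> (- y + x)) * (sqrt (\<tau> (- y + x)) * a y))"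
      using \<tau>0 by (simp add: mult.assoc[symmetric])
    finally have le: "(\<Sum>y\<in>F. cmod (t x y * ell2_apply \<xi> y)) \<le>
        (\<Sum>y\<in>F. sqrt (\<tau> (- y + x)) * (sqrt (\<tau> (- y + x)) * a y))" .
    have "(\<Sum>y\<in>F. sqrt (\<tau> (- y + x)) * (sqrt (\<tau> (- y + x)) * a y))\<^sup>2 \<le>
        (\<Sum>y\<in>F. (sqrt (\<tau> (- y + x)))\<^sup>2) * (\<Sum>y\<in>F. (sqrt (\<tau> (- y + x)) * a y)\<^sup>2)"
      by (rule Cauchy_Schwarz_ineq_sum)
    also have "\<dots> = (\<Sum>y\<in>F. \<tau> (- y + x)) * (\<Sum>y\<in>F. \<tau> (- y + x) * (a y)\<^sup>2)"
      using \<tau>0 by (simp add: power_mult_distrib)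
    also have "\<dots> \<le> K * q x"
      by (intro mult_mono finite_sum_le_has_sum[OF q] K0
          finite_sum_le_has_sum[OF has_sum_left_quotient(1)[OF \<tau>]] that sum_nonneg) (auto simp: \<tau>0)
    finally show ?thesis
      by (rule order_trans[OF le real_le_rsqrt])
  qed
  have abs: "(\<lambda>y. cmod (t x y * ell2_apply \<xi> y)) summable_on UNIV" for x
    by (rule nonneg_bdd_above_summable_on) (auto intro!: bdd_aboveI2 fin)
  have h: "((\<lambda>y. t x y * ell2_apply \<xi> y) has_sum h x) UNIV" for x
    unfolding h_def by (rule has_sum_infsum[OF abs_summable_summable[OF abs]])
  have hq: "(cmod (h x))\<^sup>2 \<le> K * q x" for x
  proof -
    have "cmod (h x) \<le> (\<Sum>\<^sub>\<infinity>y. cmod (t x y * ell2_apply \<xi> y))"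
      unfolding h_def by (rule norm_infsum_bound[OF abs])
    also have "\<dots> \<le> sqrt (K * q x)"
      by (rule infsum_le_finite_sums[OF abs fin])
    finally show ?thesis
      by (metis K0 mult_nonneg_nonneg norm_ge_zero power_mono q0 real_sqrt_pow2)
  qed
  have bound: "(\<Sum>x\<in>F. (cmod (h x))\<^sup>2) \<le> (K * norm \<xi>)\<^sup>2" if "finite F" for F
  proof -
    \<comment> \<open>The sum over \<open>x\<close> stays finite, so exchanging it with the infinite
      sum over \<open>y\<close> is mere additivity of \<open>has_sum\<close>.\<close>
    have "(\<Sum>x\<in>F. q x) \<le> K * (norm \<xi>)\<^sup>2"
    proof (rule has_sum_mono)
      show "((\<lambda>y. \<Sum>x\<in>F. \<tau> (- y + x) * (a y)\<^sup>2) has_sum (\<Sum>x\<in>F. q x)) UNIV"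
        by (intro has_sum_finite_sum q)
      show "((\<lambda>y. K * (a y)\<^sup>2) has_sum K * (norm \<xi>)\<^sup>2) UNIV"
        by (rule has_sum_cmult_right[OF a_sum])
      show "(\<Sum>x\<in>F. \<tau> (- y + x) * (a y)\<^sup>2) \<le> K * (a y)\<^sup>2" for y
        unfolding sum_distrib_right[symmetric]
        by (intro mult_right_mono finite_sum_le_has_sum[OF has_sum_left_quotient(2)[OF \<tau>]] that)
          (auto simp: \<tau>0)
    qed
    then have "K * (\<Sum>x\<in>F. q x) \<le> K * (K * (norm \<xi>)\<^sup>2)"
      using K0 by (rule mult_left_mono)
    moreover have "(\<Sum>x\<in>F. (cmod (h x))\<^sup>2) \<le> K * (\<Sum>x\<in>F. q x)"
      unfolding sum_distrib_left by (intro sum_mono hq)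
    ultimately show ?thesis
      by (simp add: power_mult_distrib power2_eq_square ac_simps)
  qed
  have s: "(\<lambda>x. (cmod (h x))\<^sup>2) summable_on UNIV"
    by (rule nonneg_bdd_above_summable_on) (auto intro!: bdd_aboveI2 bound)
  then have app: "ell2_apply (Abs_ell2 h) = h"
    by (simp add: Abs_ell2_inverse)
  have "(norm (Abs_ell2 h))\<^sup>2 \<le> (K * norm \<xi>)\<^sup>2"
    unfolding norm_ell2_sq app by (rule infsum_le_finite_sums[OF s bound])
  then have "norm (Abs_ell2 h) \<le> K * norm \<xi>"
    by (rule power2_le_imp_le) (simp add: K0)
  then show ?thesis
    using h by (intro exI[of _ "Abs_ell2 h"]) (simp add: app)
qed

text \<open>Linearity follows from uniqueness of sums. The bound by the total mass of the kernel
  later controls both truncation errors and the perturbation in the inverse argument.\<close>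

lemma mat_defines_convolution_bound:
  fixes \<tau> :: "'g::group_add \<Rightarrow> real"
  assumes \<tau>: "(\<tau> has_sum K) UNIV" and t: "\<And>x y. cmod (t x y) \<le> \<tau> (- y + x)"
  obtains A where "mat_defines t A" "norm A \<le> K"
proof -
  obtain T where T: "\<And>\<xi> x. ((\<lambda>y. t x y * ell2_apply \<xi> y) has_sum ell2_apply (T \<xi>) x) UNIV"
    and norm_T: "\<And>\<xi>. norm (T \<xi>) \<le> K * norm \<xi>"
    using convolution_estimate[OF assms] by metis
  have "bounded_linear T"
  proof (rule bounded_linear_intro)
    show "T (\<xi> + \<eta>) = T \<xi> + T \<eta>" for \<xi> \<eta>
    proof (rule ell2_eqI)
      fix x
      have "((\<lambda>y. t x y * ell2_apply (\<xi> + \<eta>) y) has_sum ell2_apply (T \<xi> + T \<eta>) x) UNIV"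
        using has_sum_add[OF T[of x \<xi>] T[of x \<eta>]] by (simp add: ell2_apply_add distrib_left)
      then show "ell2_apply (T (\<xi> + \<eta>)) x = ell2_apply (T \<xi> + T \<eta>) x"
        by (rule has_sum_unique[OF T])
    qed
    show "T (r *\<^sub>R \<xi>) = r *\<^sub>R T \<xi>" for r \<xi>
    proof (rule ell2_eqI)
      fix x
      have "((\<lambda>y. t x y * ell2_apply (r *\<^sub>R \<xi>) y) has_sum ell2_apply (r *\<^sub>R T \<xi>) x) UNIV"
        using has_sum_cmult_right[OF T[of x \<xi>], of "of_real r"]
        by (simp add: ell2_apply_scaleR mult.left_commute)
      then show "ell2_apply (T (r *\<^sub>R \<xi>)) x = ell2_apply (r *\<^sub>R T \<xi>) x"
        by (rule has_sum_unique[OF T])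
    qed
    show "norm (T \<xi>) \<le> norm \<xi> * K" for \<xi>
      using norm_T by (simp add: mult.commute)
  qed
  moreover have "0 \<le> K"
    proof (rule has_sum_nonneg[OF \<tau>])
    show "0 \<le> \<tau> z" for z
      using order_trans[OF norm_ge_zero t[of z 0]] by simp
  qed
  ultimately show ?thesis
    using T norm_T
    by (intro that[of "Blinfun T"])
      (auto simp: mat_defines_def bounded_linear_Blinfun_apply intro!: norm_blinfun_bound)
qed

section \<open>Subexponential decay\<close>

text \<open>After division by \<open>a + b\<close> both terms lie between 0 and 1, where
  \<open>u \<le> u powr \<beta>\<close>, and they add up to 1.\<close>

lemma powr_add_le_powr:
  fixes a b \<beta> :: real
  assumes "0 \<le> a" "0 \<le> b" "0 < \<beta>" "\<beta> \<le> 1"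
  shows "(a + b) powr \<beta> \<le> a powr \<beta> + b powr \<beta>"
proof (cases "a + b = 0")
  case False
  define s where "s = a + b"
  have s: "s > 0" using assms False by (simp add: s_def)
  have *: "u \<le> u powr \<beta>" if "0 \<le> u" "u \<le> 1" for u
    using powr_mono'[of \<beta> 1 u] that assms by (cases "u = 0") auto
  have "1 = a / s + b / s"
    using s by (simp add: s_def add_divide_distrib[symmetric])
  also have "\<dots> \<le> (a / s) powr \<beta> + (b / s) powr \<beta>"
    using s assms by (intro add_mono *) (auto simp: s_def)
  finally have "s powr \<beta> * 1 \<le> s powr \<beta> * ((a / s) powr \<beta> + (b / s) powr \<beta>)"
    by (intro mult_left_mono) auto
  also have "\<dots> = a powr \<beta> + b powr \<beta>"
    using s assms by (simp add: distrib_left powr_mult[symmetric])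
  finally show ?thesis by (simp add: s_def)
qed (use assms in auto)

lemma summable_exp_powr:
  fixes c \<beta> :: real
  assumes "0 < c" "0 < \<beta>"
  shows "summable (\<lambda>n. exp (- c * real n powr \<beta>))"
proof (rule summable_comparison_test_bigo)
  show "summable (\<lambda>n. norm (real n powr - 2))"
    by (simp add: summable_real_powr_iff)
  show "(\<lambda>n. exp (- c * real n powr \<beta>)) \<in> O(\<lambda>n. real n powr - 2)"
    using assms by real_asymp
qed

text \<open>The admissible range of the exponents is built in, so that under property P the
  existence of some \<alpha> and \<beta> characterizes \<open>R_infinity\<close>.\<close>

definition subexp_decay :: "('g::group_add \<Rightarrow> real) \<Rightarrow> real \<Rightarrow> real \<Rightarrow> 'g mat \<Rightarrow> bool" where
  "subexp_decay l \<alpha> \<beta> t \<longleftrightarrow> 0 < \<alpha> \<and> 0 < \<beta> \<and> \<beta> < 1 \<and>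
     (\<exists>C\<ge>0. \<forall>x y. cmod (t x y) \<le> C * exp (- \<alpha> * l (- y + x) powr \<beta>))"

lemma subexp_decayI:
  assumes "0 < \<alpha>" "0 < \<beta>" "\<beta> < 1"
    and C: "\<And>x y. cmod (t x y) \<le> C * exp (- \<alpha> * l (- y + x) powr \<beta>)"
  shows "subexp_decay l \<alpha> \<beta> t"
proof -
  have "0 \<le> C"
    using order_trans[OF norm_ge_zero C[of 0 0]] by (simp add: zero_le_mult_iff)
  then show ?thesis
    using assms by (auto simp: subexp_decay_def)
qed

lemma subexp_decayE:
  assumes "subexp_decay l \<alpha> \<beta> t"
  obtains C where "0 < \<alpha>" "0 < \<beta>" "\<beta> < 1" "0 \<le> C"
    "\<And>x y. cmod (t x y) \<le> C * exp (- \<alpha> * l (- y + x) powr \<beta>)"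
  using assms by (auto simp: subexp_decay_def)

text \<open>Distinguishing \<open>u \<le> 1\<close> from \<open>u > 1\<close> gives
  \<open>u powr \<beta>' \<le> 1 + u powr \<beta>\<close>; the summand 1 costs the factor
  \<open>exp \<alpha>'\<close> in the constant. This brings two matrices to common
  exponents.\<close>

lemma subexp_decay_mono:
  assumes "subexp_decay l \<alpha> \<beta> t" "0 < \<alpha>'" "\<alpha>' \<le> \<alpha>" "0 < \<beta>'" "\<beta>' \<le> \<beta>"
    and nonneg: "\<And>z. 0 \<le> l z"
  shows "subexp_decay l \<alpha>' \<beta>' t"
proof -
  obtain C where C: "0 < \<alpha>" "0 < \<beta>" "\<beta> < 1" "0 \<le> C"
    "\<And>x y. cmod (t x y) \<le> C * exp (- \<alpha> * l (- y + x) powr \<beta>)"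
    using assms(1) by (rule subexp_decayE) blast
  have "cmod (t x y) \<le> C * exp \<alpha>' * exp (- \<alpha>' * l (- y + x) powr \<beta>')" for x y
  proof -
    let ?u = "l (- y + x)"
    have "?u powr \<beta>' \<le> 1 + ?u powr \<beta>"
    proof (cases "?u \<le> 1")
      case True
      then show ?thesis
        using powr_le1[of \<beta>' ?u] powr_ge_zero[of ?u \<beta>] nonneg[of "- y + x"] assms by (simp add: add_increasing2)
    next
      case False
      then show ?thesis
        using powr_mono[of \<beta>' \<beta> ?u] assms by linarith
    qed
    then have "\<alpha>' * ?u powr \<beta>' \<le> \<alpha>' * (1 + ?u powr \<beta>)"
      using assms by (intro mult_left_mono) auto
    also have "\<dots> \<le> \<alpha>' + \<alpha> * ?u powr \<beta>"
      using assms by (simp add: distrib_left mult_right_mono)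
    finally have "exp (- \<alpha> * ?u powr \<beta>) \<le> exp (\<alpha>' + - \<alpha>' * ?u powr \<beta>')"
      by simp
    then have "C * exp (- \<alpha> * ?u powr \<beta>) \<le> C * (exp \<alpha>' * exp (- \<alpha>' * ?u powr \<beta>'))"
      using C by (intro mult_left_mono) (auto simp only: exp_add)
    with C(5)[of x y] show ?thesis
      by (simp only: mult.assoc)
  qed
  then show ?thesis
    using assms C by (intro subexp_decayI) auto
qed

lemma subexp_decay_add:
  assumes "subexp_decay l \<alpha> \<beta> (entry A)" "subexp_decay l \<alpha> \<beta> (entry B)"
  shows "subexp_decay l \<alpha> \<beta> (entry (A + B))"
proof -
  obtain C where C: "0 < \<alpha>" "0 < \<beta>" "\<beta> < 1"
    "\<And>x y. cmod (entry A x y) \<le> C * exp (- \<alpha> * l (- y + x) powr \<beta>)"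
    using assms(1) by (rule subexp_decayE) blast
  obtain D where D: "\<And>x y. cmod (entry B x y) \<le> D * exp (- \<alpha> * l (- y + x) powr \<beta>)"
    using assms(2) by (rule subexp_decayE) blast
  show ?thesis
    unfolding entry_add[abs_def] using C
    by (intro subexp_decayI[where C = "C + D"])
      (auto simp: distrib_right intro!: order_trans[OF norm_triangle_ineq] add_mono D C(4)[simplified] D[simplified])
qed

lemma subexp_decay_scaleC:
  assumes "subexp_decay l \<alpha> \<beta> (entry A)"
  shows "subexp_decay l \<alpha> \<beta> (entry (oper_scaleC c A))"
proof -
  obtain C where C: "0 < \<alpha>" "0 < \<beta>" "\<beta> < 1"
    "\<And>x y. cmod (entry A x y) \<le> C * exp (- \<alpha> * l (- y + x) powr \<beta>)"
    using assms(1) by (rule subexp_decayE) blast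
  show ?thesis
    unfolding entry_scaleC[abs_def] using C
    by (intro subexp_decayI[where C = "cmod c * C"])
      (auto simp: norm_mult mult.assoc intro!: mult_left_mono C(4)[simplified])
qed

text \<open>A single term of the weighted sum is at most the total \<open>m\<close>. Taking square
  roots gives decay at the full rate \<alpha> with constant \<open>sqrt m\<close>.\<close>

lemma R_spaceD:
  assumes "t \<in> R_space l \<alpha> \<beta>" "0 < \<alpha>" "0 < \<beta>" "\<beta> < 1"
  shows "subexp_decay l \<alpha> \<beta> t"
proof -
  let ?f = "\<lambda>z. (SUP (x, y)\<in>{(x, y). - y + x = z}. ennreal (cmod (t x y)))\<^sup>2
             * ennreal (exp (2 * \<alpha> * l z powr \<beta>))"
  obtain m where m: "0 \<le> m" "(\<Sum>\<^sub>\<infinity>z. ?f z) = ennreal m"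
    using assms(1) unfolding R_space_def R_norm_sq_def
    by (auto simp: less_top_ennreal infinity_ennreal_def)
  have "cmod (t x y) \<le> sqrt m * exp (- \<alpha> * l (- y + x) powr \<beta>)" for x y
  proof -
    define z where "z = - y + x"
    define u where "u = l z powr \<beta>"
    have "ennreal (cmod (t x y)) \<le> (SUP (x, y)\<in>{(x, y). - y + x = z}. ennreal (cmod (t x y)))"
      by (rule SUP_upper2[of "(x, y)"]) (auto simp: z_def)
    then have "(ennreal (cmod (t x y)))\<^sup>2 * ennreal (exp (2 * \<alpha> * u)) \<le> ?f z"
      unfolding u_def by (intro mult_right_mono power_mono) auto
    also have "?f z = infsum ?f {z}"
      by simp
    also have "\<dots> \<le> ennreal m"
      unfolding m(2)[symmetric] by (rule infsum_mono_neutral) (auto intro: nonneg_summable_on_complete)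
    finally have "(cmod (t x y))\<^sup>2 * exp (2 * \<alpha> * u) \<le> m"
      using m by (simp add: ennreal_power ennreal_mult'[symmetric])
    moreover have "exp (2 * \<alpha> * u) = (exp (\<alpha> * u))\<^sup>2"
      by (simp add: power2_eq_square exp_add[symmetric])
    ultimately have "(cmod (t x y) * exp (\<alpha> * u))\<^sup>2 \<le> m"
      by (simp add: power_mult_distrib)
    then have "cmod (t x y) * exp (\<alpha> * u) \<le> sqrt m"
      by (rule real_le_rsqrt)
    then show ?thesis
      by (simp add: exp_minus field_simps u_def z_def)
  qed
  with assms show ?thesis
    by (intro subexp_decayI) auto
qed

text \<open>The difference is at most \<open>\<epsilon> * u * exp (\<epsilon> * u)\<close>. Both the
  factor \<open>u\<close>, scaled by \<alpha>/4, and the exponential are absorbed into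
  \<open>exp (\<alpha> * u / 4)\<close>: half of the decay survives and a factor proportional to
  \<epsilon> is gained.\<close>

lemma exp_perturbation_bound:
  fixes s u \<alpha> \<epsilon> :: real
  assumes "\<bar>s\<bar> \<le> \<epsilon> * u" "0 \<le> u" "0 < \<alpha>" "0 < \<epsilon>" "\<epsilon> \<le> \<alpha> / 4"
  shows "exp (- \<alpha> * u) * \<bar>exp s - 1\<bar> \<le> 4 * \<epsilon> / \<alpha> * exp (- (\<alpha> / 2) * u)"
proof -
  let ?v = "\<epsilon> * u"
  have v: "0 \<le> ?v" "?v \<le> \<alpha> * u / 4"
    using assms mult_right_mono[of \<epsilon> "\<alpha> / 4" u] by auto
  \<comment> \<open>For negative \<open>s\<close> this amounts to
    \<open>exp s + exp (- s) \<ge> 2\<close>.\<close>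
  have "\<bar>exp s - 1\<bar> \<le> exp \<bar>s\<bar> - 1"
  proof (cases "0 \<le> s")
    case False
    moreover have "1 + s \<le> exp s" "1 + - s \<le> exp (- s)"
      by (rule exp_ge_add_one_self)+
    moreover have "exp s \<le> 1"
      using False by simp
    ultimately show ?thesis
      unfolding abs_of_neg[of s, OF False[unfolded not_le]] by linarith
  qed simp
  also have "\<dots> \<le> exp ?v - 1"
    using assms by simp
  \<comment> \<open>This is \<open>1 - v \<le> exp (- v)\<close> multiplied by
    \<open>exp v\<close>.\<close>
  also have "\<dots> \<le> ?v * exp ?v"
    using mult_right_mono[OF exp_ge_add_one_self[of "- ?v"], of "exp ?v"]
    by (simp add: exp_minus algebra_simps)
  also have "\<dots> = 4 * \<epsilon> / \<alpha> * ((\<alpha> * u / 4) * exp ?v)"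
    using assms by simp
  also have "\<dots> \<le> 4 * \<epsilon> / \<alpha> * (exp (\<alpha> * u / 4) * exp (\<alpha> * u / 4))"
  proof (intro mult_left_mono mult_mono)
    show "\<alpha> * u / 4 \<le> exp (\<alpha> * u / 4)"
      using exp_ge_add_one_self[of "\<alpha> * u / 4"] by linarith
  qed (use assms v in auto)
  also have "exp (\<alpha> * u / 4) * exp (\<alpha> * u / 4) = exp (\<alpha> * u / 2)"
    by (simp add: exp_add[symmetric])
  finally have "exp (- \<alpha> * u) * \<bar>exp s - 1\<bar> \<le> exp (- \<alpha> * u) * (4 * \<epsilon> / \<alpha> * exp (\<alpha> * u / 2))"
    by (rule mult_left_mono) simp
  also have "\<dots> = 4 * \<epsilon> / \<alpha> * exp (- \<alpha> * u + \<alpha> * u / 2)"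
    by (simp only: exp_add ac_simps)
  also have "- \<alpha> * u + \<alpha> * u / 2 = - (\<alpha> / 2) * u"
    by (simp add: field_simps)
  finally show ?thesis .
qed

text \<open>The norm of an operator bounds its entries, so only propagation remains to be
  checked.\<close>

lemma entry_mem_algebraic_Roe_iff: "entry A \<in> algebraic_Roe l \<longleftrightarrow> finite_propagation l (entry A)"
  by (auto simp: algebraic_Roe_def intro!: exI[of _ "norm A"] cmod_entry_le)

section \<open>Consequences of the axioms of a length function\<close>

context
  fixes l :: "'g::group_add \<Rightarrow> real"
  assumes l: "proper_length l"
begin

lemma length_nonneg: "0 \<le> l x"
  and length_zero: "l 0 = 0"
  and length_minus: "l (- x) = l x"
  and length_add: "l (x + y) \<le> l x + l y"
  and finite_length_le: "0 \<le> r \<Longrightarrow> finite {x. l x \<le> r}"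
  using l unfolding proper_length_def by blast+

lemma length_add_powr:
  assumes "0 < \<beta>" "\<beta> < 1"
  shows "l (x + y) powr \<beta> \<le> l x powr \<beta> + l y powr \<beta>"
  using powr_mono2[OF _ length_nonneg length_add, of \<beta> x y]
    powr_add_le_powr[of "l x" "l y" \<beta>] assms length_nonneg by force

lemma subexp_decay_id: "subexp_decay l 1 (1 / 2) (entry id_blinfun)"
  by (rule subexp_decayI[where C = 1]) (auto simp: entry_id length_zero)

lemma algebra_algebraic_Roe: "unital_operator_algebra (opers_of (algebraic_Roe l))"
proof (rule unital_operator_algebra_opers_of;
    unfold entry_mem_algebraic_Roe_iff finite_propagation_def length_dist_def)
  show "\<exists>R>0. \<forall>x y. R < l (- y + x) \<longrightarrow> entry id_blinfun x y = 0"
    by (intro exI[of _ 1]) (auto simp: entry_id length_zero)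
next
  fix A B :: "'g oper"
  assume "\<exists>R>0. \<forall>x y. R < l (- y + x) \<longrightarrow> entry A x y = 0"
    and "\<exists>R>0. \<forall>x y. R < l (- y + x) \<longrightarrow> entry B x y = 0"
  then obtain R R' where "R > 0" "\<And>x y. R < l (- y + x) \<Longrightarrow> entry A x y = 0"
    "R' > 0" "\<And>x y. R' < l (- y + x) \<Longrightarrow> entry B x y = 0" by blast
  then show "\<exists>R>0. \<forall>x y. R < l (- y + x) \<longrightarrow> entry (A + B) x y = 0"
    by (intro exI[of _ "max R R'"]) (auto simp: entry_add)
next
  fix c and A :: "'g oper"
  assume "\<exists>R>0. \<forall>x y. R < l (- y + x) \<longrightarrow> entry A x y = 0"
  then show "\<exists>R>0. \<forall>x y. R < l (- y + x) \<longrightarrow> entry (oper_scaleC c A) x y = 0"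
    by (auto simp: entry_scaleC)
next
  fix A B :: "'g oper"
  assume A: "complex_linear A"
    and "\<exists>R>0. \<forall>x y. R < l (- y + x) \<longrightarrow> entry A x y = 0"
    and "\<exists>R>0. \<forall>x y. R < l (- y + x) \<longrightarrow> entry B x y = 0"
  then obtain R R' where R: "R > 0" "\<And>x y. R < l (- y + x) \<Longrightarrow> entry A x y = 0"
    "R' > 0" "\<And>x y. R' < l (- y + x) \<Longrightarrow> entry B x y = 0" by blast
  have "entry (A o\<^sub>L B) x w = 0" if xw: "R + R' < l (- w + x)" for x w
  proof -
    \<comment> \<open>As \<open>- w + x\<close> is the sum of \<open>- w + y\<close> and
      \<open>- y + x\<close>, the triangle inequality puts one of the two factors beyond its
      propagation bound.\<close>
    have "entry A x y * entry B y w = 0" for y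
      using R(2)[of y x] R(4)[of w y] xw length_add[of "- w + y" "- y + x"]
      by (force simp: add.assoc)
    then have "((\<lambda>y. entry A x y * entry B y w) has_sum 0) UNIV"
      by (intro has_sum_0)
    then show ?thesis
      using entry_compose[OF A] has_sum_unique by blast
  qed
  then show "\<exists>R>0. \<forall>x y. R < l (- y + x) \<longrightarrow> entry (A o\<^sub>L B) x y = 0"
    using R by (intro exI[of _ "R + R'"]) auto
qed

section \<open>Decay estimates that rest on property P\<close>

context
  assumes P: "property_P l"
begin

text \<open>The group is cut into shells \<open>n \<le> l z < n + 1\<close>. Property P with rate
  \<alpha>/2 bounds their cardinalities, which costs half of the decay; the other half is summable
  over \<open>n\<close>.\<close>

lemma length_powr_summable:
  assumes \<alpha>: "0 < \<alpha>" and \<beta>: "0 < \<beta>" "\<beta> < 1"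
  shows "(\<lambda>z. exp (- \<alpha> * l z powr \<beta>)) summable_on UNIV"
proof -
  have "0 < \<alpha> / 2" using \<alpha> by simp
  then obtain C where C: "\<And>x r. 0 < r \<Longrightarrow>
      real (card (length_ball l x r)) \<le> C * exp (\<alpha> / 2 * r powr \<beta>)"
    using P \<beta> unfolding property_P_def by metis
  have C0: "0 \<le> C"
    using order_trans[OF of_nat_0_le_iff C[of 1 0]] by (simp add: zero_le_mult_iff)
  define N where "N z = nat \<lfloor>l z\<rfloor>" for z
  define g where "g n = C * exp (\<alpha> / 2) * exp (- (\<alpha> / 2) * real n powr \<beta>)" for n
  have g: "summable g" "\<And>n. 0 \<le> g n"
    unfolding g_def using summable_exp_powr[of "\<alpha> / 2" \<beta>] \<alpha> \<beta> C0 by (auto intro!: summable_mult)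
  have shell: "(\<Sum>z\<in>{z \<in> S. N z = n}. exp (- \<alpha> * l z powr \<beta>)) \<le> g n" if "finite S" for S n
  proof -
    have N: "real n \<le> l z" "l z < real n + 1" if "N z = n" for z
      using that length_nonneg[of z] unfolding N_def by linarith+
    have "(\<Sum>z\<in>{z \<in> S. N z = n}. exp (- \<alpha> * l z powr \<beta>))
        \<le> real (card {z \<in> S. N z = n}) * exp (- \<alpha> * real n powr \<beta>)"
      using \<alpha> \<beta> N by (intro sum_bounded_above) (auto intro!: powr_mono2)
    also have "\<dots> \<le> (C * exp (\<alpha> / 2 * (real n + 1) powr \<beta>)) * exp (- \<alpha> * real n powr \<beta>)"
    proof (rule mult_right_mono)
      have ball: "length_ball l 0 (real n + 1) = {z. l z < real n + 1}"
        by (simp add: length_ball_def length_dist_def length_minus)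
      \<comment> \<open>Since \<open>card\<close> of an infinite set is 0, the comparison of
        cardinalities depends on this finiteness, which comes from properness.\<close>
      have "finite (length_ball l 0 (real n + 1))"
        unfolding ball by (rule finite_subset[OF _ finite_length_le[of "real n + 1"]]) auto
      then have "card {z \<in> S. N z = n} \<le> card (length_ball l 0 (real n + 1))"
        by (rule card_mono) (auto simp: ball intro!: N(2))
      then show "real (card {z \<in> S. N z = n}) \<le> C * exp (\<alpha> / 2 * (real n + 1) powr \<beta>)"
        using C[of "real n + 1" 0] by linarith
    qed simp
    \<comment> \<open>Subadditivity of the power trades the radius \<open>n + 1\<close> for
      \<open>n\<close>; the additional 1 becomes the factor \<open>exp (\<alpha> / 2)\<close> in
      \<open>g\<close>.\<close>
    also have "\<dots> \<le> (C * exp (\<alpha> / 2 * (real n powr \<beta> + 1))) * exp (- \<alpha> * real n powr \<beta>)"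
      using powr_add_le_powr[of "real n" 1 \<beta>] \<alpha> \<beta> C0
      by (intro mult_right_mono mult_left_mono) auto
    also have "\<dots> = C * exp (\<alpha> / 2 * (real n powr \<beta> + 1) + - \<alpha> * real n powr \<beta>)"
      by (simp only: mult.assoc exp_add)
    also have "\<dots> = C * exp (\<alpha> / 2 + - (\<alpha> / 2) * real n powr \<beta>)"
      by (simp add: field_simps)
    also have "\<dots> = g n"
      by (simp only: g_def exp_add mult.assoc)
    finally show ?thesis .
  qed
  show ?thesis
  proof (rule nonneg_bdd_above_summable_on)
    show "bdd_above (sum (\<lambda>z. exp (- \<alpha> * l z powr \<beta>)) ` {F. F \<subseteq> UNIV \<and> finite F})"
    proof (rule bdd_aboveI2)
      fix S :: "'g set" assume "S \<in> {F. F \<subseteq> UNIV \<and> finite F}"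
      then have S: "finite S" by simp
      have "(\<Sum>z\<in>S. exp (- \<alpha> * l z powr \<beta>))
          = (\<Sum>n\<in>N ` S. \<Sum>z\<in>{z \<in> S. N z = n}. exp (- \<alpha> * l z powr \<beta>))"
        by (rule sum.image_gen[OF S])
      also have "\<dots> \<le> (\<Sum>n\<in>N ` S. g n)"
        by (intro sum_mono shell S)
      also have "\<dots> \<le> suminf g"
        using g S by (intro sum_le_suminf) auto
      finally show "(\<Sum>z\<in>S. exp (- \<alpha> * l z powr \<beta>)) \<le> suminf g" .
    qed
  qed simp
qed

text \<open>The squared bound decays at rate \<open>2 * \<alpha>\<close>. Halving the rate in the
  weight leaves decay at rate \<alpha>, which is summable; the loss disappears in the union over all
  rates.\<close>

lemma R_spaceI:
  assumes "subexp_decay l \<alpha> \<beta> t"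
  shows "t \<in> R_space l (\<alpha> / 2) \<beta>"
proof -
  obtain C where C: "0 < \<alpha>" "0 < \<beta>" "\<beta> < 1" "0 \<le> C"
    "\<And>x y. cmod (t x y) \<le> C * exp (- \<alpha> * l (- y + x) powr \<beta>)"
    using assms by (rule subexp_decayE) blast
  let ?g = "\<lambda>z. C\<^sup>2 * exp (- \<alpha> * l z powr \<beta>)"
  have g: "?g summable_on UNIV"
    using C by (intro summable_on_cmult_right length_powr_summable)
  let ?f = "\<lambda>z. (SUP (x, y)\<in>{(x, y). - y + x = z}. ennreal (cmod (t x y)))\<^sup>2
             * ennreal (exp (2 * (\<alpha> / 2) * l z powr \<beta>))"
  have fg: "?f z \<le> ennreal (?g z)" for z
  proof -
    let ?u = "l z powr \<beta>"
    have "(SUP (x, y)\<in>{(x, y). - y + x = z}. ennreal (cmod (t x y))) \<le> ennreal (C * exp (- \<alpha> * ?u))"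
      using C(5) by (auto intro!: SUP_least ennreal_leI)
    then have "?f z \<le> (ennreal (C * exp (- \<alpha> * ?u)))\<^sup>2 * ennreal (exp (2 * (\<alpha> / 2) * ?u))"
      by (intro mult_right_mono power_mono) auto
    also have "\<dots> = ennreal ((C * exp (- \<alpha> * ?u))\<^sup>2 * exp (2 * (\<alpha> / 2) * ?u))"
      using C by (simp add: ennreal_power ennreal_mult'[symmetric])
    also have "(C * exp (- \<alpha> * ?u))\<^sup>2 * exp (2 * (\<alpha> / 2) * ?u) = ?g z"
      by (simp add: power2_eq_square exp_minus field_simps)
    finally show ?thesis .
  qed
  have "infsum ?f UNIV \<le> ennreal (infsum ?g UNIV)"
  proof (rule infsum_le_finite_sums)
    fix F :: "'g set" assume F: "finite F"
    have "sum ?f F \<le> (\<Sum>z\<in>F. ennreal (?g z))"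
      by (intro sum_mono fg)
    also have "\<dots> = ennreal (sum ?g F)"
      by (intro sum_ennreal) auto
    also have "\<dots> \<le> ennreal (infsum ?g UNIV)"
      by (intro ennreal_leI finite_sum_le_infsum g F) auto
    finally show "sum ?f F \<le> ennreal (infsum ?g UNIV)" .
  qed (rule nonneg_summable_on_complete, simp)
  then show ?thesis
    unfolding R_space_def R_norm_sq_def
    by (auto simp: infinity_ennreal_def intro: le_less_trans)
qed

lemma R_infinity_iff: "t \<in> R_infinity l \<longleftrightarrow> (\<exists>\<alpha> \<beta>. subexp_decay l \<alpha> \<beta> t)"
proof
  assume "t \<in> R_infinity l"
  then show "\<exists>\<alpha> \<beta>. subexp_decay l \<alpha> \<beta> t"
    unfolding R_infinity_def using R_spaceD by fastforce
next
  assume "\<exists>\<alpha> \<beta>. subexp_decay l \<alpha> \<beta> t"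
  then obtain \<alpha> \<beta> where t: "subexp_decay l \<alpha> \<beta> t" by blast
  then show "t \<in> R_infinity l"
    using R_spaceI[OF t] unfolding R_infinity_def subexp_decay_def
    by (intro UN_I[of "\<alpha> / 2"] UN_I[of \<beta>]) auto
qed

lemma R_infinity_common_exponents:
  assumes "s \<in> R_infinity l" "t \<in> R_infinity l"
  obtains \<alpha> \<beta> where "subexp_decay l \<alpha> \<beta> s" "subexp_decay l \<alpha> \<beta> t"
proof -
  obtain \<alpha> \<beta> \<alpha>' \<beta>' where *: "subexp_decay l \<alpha> \<beta> s" "subexp_decay l \<alpha>' \<beta>' t"
    using assms unfolding R_infinity_iff by blast
  then have "0 < min \<alpha> \<alpha>'" "0 < min \<beta> \<beta>'"
    by (auto simp: subexp_decay_def)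
  with * show ?thesis
    by (intro that[of "min \<alpha> \<alpha>'" "min \<beta> \<beta>'"]; elim subexp_decay_mono) (auto simp: length_nonneg)
qed

text \<open>This justifies identifying matrices with operators: passing to
  \<open>opers_of (R_infinity l)\<close> discards no matrix.\<close>

lemma R_infinity_defines:
  assumes "t \<in> R_infinity l"
  shows "\<exists>A. mat_defines t A"
proof -
  obtain \<alpha> \<beta> where "subexp_decay l \<alpha> \<beta> t"
    using assms unfolding R_infinity_iff by blast
  then obtain C where C: "0 < \<alpha>" "0 < \<beta>" "\<beta> < 1"
    "\<And>x y. cmod (t x y) \<le> C * exp (- \<alpha> * l (- y + x) powr \<beta>)"
    by (rule subexp_decayE) blast
  have "(\<lambda>z. C * exp (- \<alpha> * l z powr \<beta>)) summable_on UNIV"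
    using C by (intro summable_on_cmult_right length_powr_summable)
  from mat_defines_convolution_bound[OF has_sum_infsum[OF this], of t, OF C(4)]
  show ?thesis by blast
qed

text \<open>Half of the decay of both factors pays, by subadditivity, for the decay of the product;
  the other half of the decay of \<open>A\<close> makes the sum over \<open>y\<close> converge to
  \<open>K\<close>.\<close>

lemma subexp_decay_compose:
  assumes "complex_linear A" "subexp_decay l \<alpha> \<beta> (entry A)" "subexp_decay l \<alpha> \<beta> (entry B)"
  shows "subexp_decay l (\<alpha> / 2) \<beta> (entry (A o\<^sub>L B))"
proof -
  obtain C where C: "0 < \<alpha>" "0 < \<beta>" "\<beta> < 1" "0 \<le> C"
    "\<And>x y. cmod (entry A x y) \<le> C * exp (- \<alpha> * l (- y + x) powr \<beta>)"
    using assms(2) by (rule subexp_decayE) blast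
  obtain D where D: "0 \<le> D" "\<And>x y. cmod (entry B x y) \<le> D * exp (- \<alpha> * l (- y + x) powr \<beta>)"
    using assms(3) by (rule subexp_decayE) blast
  define K where "K = (\<Sum>\<^sub>\<infinity>z. exp (- (\<alpha> / 2) * l z powr \<beta>))"
  have K: "((\<lambda>z. exp (- (\<alpha> / 2) * l z powr \<beta>)) has_sum K) UNIV"
    unfolding K_def using C by (intro has_sum_infsum length_powr_summable) auto
  have "cmod (entry (A o\<^sub>L B) x w) \<le> (C * D * K) * exp (- (\<alpha> / 2) * l (- w + x) powr \<beta>)" for x w
  proof -
    let ?e = "exp (- (\<alpha> / 2) * l (- w + x) powr \<beta>)"
    have "cmod (entry (A o\<^sub>L B) x w) \<le> C * D * ?e * K"
    proof (rule norm_infsum_le[OF entry_compose[OF assms(1)]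
          has_sum_cmult_right[OF has_sum_left_quotient(1)[OF K, of x]]])
      fix y
      let ?a = "l (- y + x) powr \<beta>" and ?b = "l (- w + y) powr \<beta>"
      have "l (- w + x) powr \<beta> \<le> ?b + ?a"
        using length_add_powr[of \<beta> "- w + y" "- y + x"] C by (simp add: add.assoc)
      then have "(\<alpha> / 2) * l (- w + x) powr \<beta> \<le> (\<alpha> / 2) * (?b + ?a)"
        using C by (intro mult_left_mono) auto
      \<comment> \<open>The remaining half of the decay of \<open>B\<close> is given away
        here.\<close>
      moreover have "0 \<le> (\<alpha> / 2) * ?b" using C by simp
      ultimately have "- \<alpha> * ?a + - \<alpha> * ?b \<le> - (\<alpha> / 2) * l (- w + x) powr \<beta> + - (\<alpha> / 2) * ?a"
        by (simp add: field_simps)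
      then have "exp (- \<alpha> * ?a) * exp (- \<alpha> * ?b) \<le> ?e * exp (- (\<alpha> / 2) * ?a)"
        by (simp only: exp_add[symmetric] exp_le_cancel_iff)
      then have "C * D * (exp (- \<alpha> * ?a) * exp (- \<alpha> * ?b)) \<le> C * D * (?e * exp (- (\<alpha> / 2) * ?a))"
        using C D by (intro mult_left_mono) auto
      moreover have "cmod (entry A x y * entry B y w) \<le> (C * exp (- \<alpha> * ?a)) * (D * exp (- \<alpha> * ?b))"
        unfolding norm_mult using C D by (intro mult_mono) auto
      ultimately show "cmod (entry A x y * entry B y w) \<le> C * D * ?e * exp (- (\<alpha> / 2) * ?a)"
        by (simp only: ac_simps)
    qed
    then show ?thesis by (simp only: ac_simps)
  qed
  then show ?thesis
    using C by (intro subexp_decayI) auto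
qed

lemma algebra_R_infinity: "unital_operator_algebra (opers_of (R_infinity l))"
proof (rule unital_operator_algebra_opers_of)
  show "entry id_blinfun \<in> R_infinity l"
    using subexp_decay_id R_infinity_iff by blast
  show "entry (A + B) \<in> R_infinity l"
    if "entry A \<in> R_infinity l" "entry B \<in> R_infinity l" for A B
    using that R_infinity_common_exponents subexp_decay_add R_infinity_iff by metis
  show "entry (oper_scaleC c A) \<in> R_infinity l" if "entry A \<in> R_infinity l" for c A
    using that subexp_decay_scaleC R_infinity_iff by metis
  show "entry (A o\<^sub>L B) \<in> R_infinity l"
    if "complex_linear A" "entry A \<in> R_infinity l" "entry B \<in> R_infinity l" for A B
    using that R_infinity_common_exponents subexp_decay_compose R_infinity_iff by metis
qed

text \<open>Where entries may be nonzero the length is at most \<open>R\<close>, so the weight is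
  bounded below and the constant \<open>exp (R powr (1 / 2))\<close> compensates for it. The
  exponents 1 and 1/2 are an arbitrary choice.\<close>

lemma algebraic_Roe_subset: "algebraic_Roe l \<subseteq> R_infinity l"
proof
  fix t assume "t \<in> algebraic_Roe l"
  then obtain M R where M: "\<And>x y. cmod (t x y) \<le> M"
    and R: "0 < R" "\<And>x y. R < l (- y + x) \<Longrightarrow> t x y = 0"
    unfolding algebraic_Roe_def finite_propagation_def length_dist_def by blast
  have M0: "0 \<le> M"
    using order_trans[OF norm_ge_zero M[of 0 0]] .
  have "cmod (t x y) \<le> M * exp (R powr (1 / 2)) * exp (- 1 * l (- y + x) powr (1 / 2))" for x y
  proof (cases "R < l (- y + x)")
    case False
    then have "l (- y + x) powr (1 / 2) \<le> R powr (1 / 2)"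
      by (intro powr_mono2) (auto simp: length_nonneg)
    then have "M * 1 \<le> M * exp (R powr (1 / 2) + - 1 * l (- y + x) powr (1 / 2))"
      using M0 by (intro mult_left_mono) auto
    also have "\<dots> = M * exp (R powr (1 / 2)) * exp (- 1 * l (- y + x) powr (1 / 2))"
      by (simp only: exp_add mult.assoc)
    finally show ?thesis
      using M[of x y] by linarith
  qed (use R M0 in auto)
  then have "subexp_decay l 1 (1 / 2) t"
    by (intro subexp_decayI) auto
  then show "t \<in> R_infinity l"
    using R_infinity_iff by blast
qed

text \<open>A finite set \<open>F\<close> of left quotients carries all but \<open>e / 2\<close> of
  the mass of the dominating kernel. The part of \<open>A\<close> off \<open>F\<close> is an
  operator \<open>E\<close> with norm at most that tail, and \<open>A - E\<close> has finite
  propagation.\<close>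

lemma opers_R_infinity_subset: "opers_of (R_infinity l) \<subseteq> uniform_Roe l"
proof
  fix A assume "A \<in> opers_of (R_infinity l)"
  then obtain \<alpha> \<beta> where A: "complex_linear A" "subexp_decay l \<alpha> \<beta> (entry A)"
    unfolding mem_opers_of_iff R_infinity_iff by blast
  from A(2) obtain C where C: "0 < \<alpha>" "0 < \<beta>" "\<beta> < 1" "0 \<le> C"
    "\<And>x y. cmod (entry A x y) \<le> C * exp (- \<alpha> * l (- y + x) powr \<beta>)"
    by (rule subexp_decayE) blast
  let ?\<tau> = "\<lambda>z. C * exp (- \<alpha> * l z powr \<beta>)"
  have \<tau>: "?\<tau> summable_on UNIV"
    using C by (intro summable_on_cmult_right length_powr_summable)
  show "A \<in> uniform_Roe l"
    unfolding uniform_Roe_def closure_approachable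
  proof (intro allI impI)
    fix e :: real assume "0 < e"
    then obtain F where F: "finite F" "dist (sum ?\<tau> F) (infsum ?\<tau> UNIV) \<le> e / 2"
      using infsum_finite_approximation[OF \<tau>, of "e / 2"] by auto
    have "((\<lambda>z. if z \<in> F then ?\<tau> z else 0) has_sum sum ?\<tau> F) UNIV"
      by (rule has_sum_finite_neutralI[OF F(1)]) auto
    then have "((\<lambda>z. ?\<tau> z + - (if z \<in> F then ?\<tau> z else 0)) has_sum
        infsum ?\<tau> UNIV + - sum ?\<tau> F) UNIV"
      by (intro has_sum_add has_sum_infsum \<tau>) (simp only: has_sum_uminus minus_minus)
    moreover define s where "s x y = (if - y + x \<in> F then 0 else entry A x y)" for x y
    moreover have "cmod (s x y) \<le> ?\<tau> (- y + x) + - (if - y + x \<in> F then ?\<tau> (- y + x) else 0)"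
      for x y
      using C(5)[of x y] by (auto simp: s_def)
    ultimately obtain E where E: "mat_defines s E" "norm E \<le> infsum ?\<tau> UNIV + - sum ?\<tau> F"
      using mat_defines_convolution_bound by blast
    have entry: "entry (A - E) x y = (if - y + x \<in> F then entry A x y else 0)" for x y
    proof -
      have "entry E = s"
        using E(1) by (simp add: mat_defines_iff)
      then show ?thesis
        by (simp add: entry_diff s_def)
    qed
    have "finite_propagation l (entry (A - E))"
      unfolding finite_propagation_def length_dist_def
    proof (intro exI conjI allI impI)
      \<comment> \<open>The sum dominates each length occurring in \<open>F\<close>; adding 1 keeps
        the bound positive even if the sum is 0.\<close>
      show "0 < 1 + sum l F"
        by (simp add: add_pos_nonneg sum_nonneg length_nonneg)
      fix x y assume "1 + sum l F < l (- y + x)"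
      moreover have "l z \<le> sum l F" if "z \<in> F" for z
        using F(1) that length_nonneg by (intro member_le_sum) auto
      ultimately have "- y + x \<notin> F" by force
      then show "entry (A - E) x y = 0"
        by (simp add: entry)
    qed
    then have "A - E \<in> opers_of (algebraic_Roe l)"
      using A(1) E(1) by (simp add: mem_opers_of_iff entry_mem_algebraic_Roe_iff
          complex_linear_diff mat_defines_iff)
    moreover have "dist (A - E) A < e"
      using E(2) F(2) \<open>0 < e\<close> by (simp add: dist_norm abs_real_def split: if_splits)
    ultimately show "\<exists>B\<in>opers_of (algebraic_Roe l). dist B A < e" by blast
  qed
qed

section \<open>Inverses\<close>

text \<open>The conjugation is carried out on one vector: \<open>\<eta>\<close> is column
  \<open>q\<close> of \<open>B\<close> and \<open>\<xi>\<close> its weighted version. The matrix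
  \<open>s\<close> of \<open>E\<close> is that of the conjugated operator minus \<open>A\<close>, so
  \<open>A \<xi> + E \<xi> = ell2_delta q\<close>, which bounds \<open>\<xi>\<close> once
  \<open>E\<close> is small.\<close>

lemma subexp_decay_inverse:
  assumes A: "complex_linear A" and decay: "subexp_decay l \<alpha> \<beta> (entry A)"
    and AB: "A o\<^sub>L B = id_blinfun" and BA: "B o\<^sub>L A = id_blinfun"
  shows "\<exists>\<epsilon>. subexp_decay l \<epsilon> \<beta> (entry B)"
proof -
  obtain C where C: "0 < \<alpha>" "0 < \<beta>" "\<beta> < 1" "0 \<le> C"
    "\<And>x y. cmod (entry A x y) \<le> C * exp (- \<alpha> * l (- y + x) powr \<beta>)"
    using decay by (rule subexp_decayE) blast
  define K where "K = (\<Sum>\<^sub>\<infinity>z. exp (- (\<alpha> / 2) * l z powr \<beta>))"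
  have K: "((\<lambda>z. exp (- (\<alpha> / 2) * l z powr \<beta>)) has_sum K) UNIV"
    unfolding K_def using C by (intro has_sum_infsum length_powr_summable) auto
  have "0 \<le> K"
    using has_sum_nonneg[OF K] by simp
  \<comment> \<open>Chosen so that \<open>norm E * norm B \<le> \<epsilon> * Q\<close>
    below.\<close>
  define Q where "Q = 4 * C * K / \<alpha> * norm B"
  have Q: "0 \<le> Q"
    using C \<open>0 \<le> K\<close> by (simp add: Q_def)
  \<comment> \<open>The first bound serves \<open>exp_perturbation_bound\<close>, the second gives
    \<open>\<epsilon> * Q \<le> 1 / 2\<close>; \<open>1 + Q\<close> avoids division by 0. Neither
    depends on \<open>p\<close> or \<open>q\<close>.\<close>
  define \<epsilon> where "\<epsilon> = min (\<alpha> / 4) (1 / (2 * (1 + Q)))"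
  have \<epsilon>: "0 < \<epsilon>" "\<epsilon> \<le> \<alpha> / 4" "\<epsilon> \<le> 1 / (2 * (1 + Q))"
    using C Q by (auto simp: \<epsilon>_def)
  have "\<epsilon> * Q \<le> 1 / (2 * (1 + Q)) * Q"
    using \<epsilon> Q by (intro mult_right_mono)
  also have "\<dots> \<le> 1 / 2"
    using Q by (simp add: field_simps)
  finally have \<epsilon>Q: "\<epsilon> * Q \<le> 1 / 2" .
  have "cmod (entry B p q) \<le> 2 * norm B * exp (- \<epsilon> * l (- q + p) powr \<beta>)" for p q
  proof -
    \<comment> \<open>Truncating at the value at \<open>p\<close> makes the weight bounded while
      leaving it unchanged at \<open>p\<close>, the only coordinate that is read off in the
      end.\<close>
    define \<phi> where "\<phi> x = min (l (- q + x) powr \<beta>) (l (- q + p) powr \<beta>)" for x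
    define d where "d x = exp (\<epsilon> * \<phi> x)" for x
    have \<phi>_le: "\<phi> x \<le> \<phi> y + l (- y + x) powr \<beta>" for x y
      using length_add_powr[of \<beta> "- q + y" "- y + x"] C powr_ge_zero[of "l (- y + x)" \<beta>]
      by (auto simp: \<phi>_def add.assoc min_def simp del: powr_ge_zero)
    have \<phi>: "\<bar>\<phi> x - \<phi> y\<bar> \<le> l (- y + x) powr \<beta>" for x y
      using \<phi>_le[of x y] \<phi>_le[of y x] length_minus[of "- y + x"] by (simp add: minus_add abs_le_iff)
    define s where "s x y = entry A x y * of_real (d x / d y - 1)" for x y
    have "cmod (s x y) \<le> C * (4 * \<epsilon> / \<alpha>) * exp (- (\<alpha> / 2) * l (- y + x) powr \<beta>)" for x y
    proof -
      let ?u = "l (- y + x) powr \<beta>"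
      have "\<bar>\<epsilon> * (\<phi> x - \<phi> y)\<bar> \<le> \<epsilon> * ?u"
        using \<phi>[of x y] \<epsilon> by (simp add: abs_mult)
      then have *: "exp (- \<alpha> * ?u) * \<bar>exp (\<epsilon> * (\<phi> x - \<phi> y)) - 1\<bar> \<le> 4 * \<epsilon> / \<alpha> * exp (- (\<alpha> / 2) * ?u)"
        using C \<epsilon> by (intro exp_perturbation_bound) auto
      have "d x / d y = exp (\<epsilon> * (\<phi> x - \<phi> y))"
        by (simp add: d_def exp_diff right_diff_distrib)
      then have "cmod (s x y) = cmod (entry A x y) * \<bar>exp (\<epsilon> * (\<phi> x - \<phi> y)) - 1\<bar>"
        by (simp only: s_def norm_mult norm_of_real)
      also have "\<dots> \<le> (C * exp (- \<alpha> * ?u)) * \<bar>exp (\<epsilon> * (\<phi> x - \<phi> y)) - 1\<bar>"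
        by (intro mult_right_mono C) auto
      also have "\<dots> \<le> C * (4 * \<epsilon> / \<alpha> * exp (- (\<alpha> / 2) * ?u))"
        unfolding mult.assoc using C * by (intro mult_left_mono) auto
      finally show ?thesis by (simp only: mult.assoc)
    qed
    then obtain E where E: "mat_defines s E" "norm E \<le> C * (4 * \<epsilon> / \<alpha>) * K"
      using mat_defines_convolution_bound[OF has_sum_cmult_right[OF K]] by blast
    have EB: "norm E * norm B \<le> 1 / 2"
    proof -
      have "norm E * norm B \<le> C * (4 * \<epsilon> / \<alpha>) * K * norm B"
        by (intro mult_right_mono E) auto
      also have "\<dots> = \<epsilon> * Q"
        by (simp add: Q_def)
      finally show ?thesis
        using \<epsilon>Q by linarith
    qed
    define \<eta> where "\<eta> = B (ell2_delta q)"
    have A\<eta>: "A \<eta> = ell2_delta q"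
      using arg_cong[OF AB, of "\<lambda>T. T (ell2_delta q)"] by (simp add: \<eta>_def)
    have "cmod (of_real (d x)) \<le> exp (\<epsilon> * l (- q + p) powr \<beta>)" for x
      using \<epsilon> by (simp add: d_def \<phi>_def)
    then obtain \<xi> where \<xi>: "\<And>x. ell2_apply \<xi> x = of_real (d x) * ell2_apply \<eta> x"
      using ell2_bounded_multiple[of "\<lambda>x. of_real (d x)" _ \<eta>] by blast
    have dnz: "d x \<noteq> 0" for x by (simp add: d_def)
    have mA: "mat_defines (entry A) A"
      using A by (simp add: mat_defines_iff)
    have "A \<xi> = ell2_delta q - E \<xi>"
    proof (rule ell2_eqI)
      \<comment> \<open>Weighting row \<open>x\<close> of \<open>A \<eta>\<close> and writing
        \<open>\<eta>\<close> as \<open>\<xi>\<close> divided by \<open>d\<close> splits each term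
        into one for \<open>E\<close> and one for \<open>A\<close>. On the right the weight
        disappears because \<open>d q = 1\<close>.\<close>
      fix x
      have "((\<lambda>y. of_real (d x) * (entry A x y * ell2_apply \<eta> y)) has_sum
          of_real (d x) * ell2_apply (A \<eta>) x) UNIV"
        using mA unfolding mat_defines_def by (intro has_sum_cmult_right) blast
      also have "(\<lambda>y. of_real (d x) * (entry A x y * ell2_apply \<eta> y))
          = (\<lambda>y. s x y * ell2_apply \<xi> y + entry A x y * ell2_apply \<xi> y)"
        using dnz by (simp add: fun_eq_iff s_def \<xi> field_simps)
      finally have "ell2_apply (E \<xi>) x + ell2_apply (A \<xi>) x = of_real (d x) * ell2_apply (A \<eta>) x"
        using has_sum_unique has_sum_add E(1) mA unfolding mat_defines_def by blast
      also have "\<dots> = ell2_apply (ell2_delta q) x"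
        by (simp add: A\<eta> ell2_apply_delta d_def \<phi>_def length_zero)
      finally show "ell2_apply (A \<xi>) x = ell2_apply (ell2_delta q - E \<xi>) x"
        by (simp add: ell2_apply_diff algebra_simps)
    qed
    then have "\<xi> = B (ell2_delta q - E \<xi>)"
      using arg_cong[OF BA, of "\<lambda>T. T \<xi>"] by simp
    then have "norm \<xi> \<le> norm B * norm (ell2_delta q - E \<xi>)"
      using norm_blinfun by metis
    also have "\<dots> \<le> norm B * (1 + norm E * norm \<xi>)"
      using norm_triangle_ineq4[of "ell2_delta q" "E \<xi>"] norm_blinfun[of E \<xi>]
      by (intro mult_left_mono) (auto simp: norm_ell2_delta)
    also have "\<dots> = norm B + (norm E * norm B) * norm \<xi>"
      by (simp add: algebra_simps)
    \<comment> \<open>The last term is absorbed into the left side, giving a bound independent of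
      \<open>p\<close> and \<open>q\<close>.\<close>
    also have "\<dots> \<le> norm B + 1 / 2 * norm \<xi>"
      using EB by (intro add_left_mono mult_right_mono) auto
    finally have "norm \<xi> \<le> 2 * norm B" by simp
    then have "cmod (ell2_apply \<xi> p) \<le> 2 * norm B"
      using cmod_ell2_apply_le[of \<xi> p] by linarith
    moreover have "ell2_apply \<xi> p = of_real (exp (\<epsilon> * l (- q + p) powr \<beta>)) * entry B p q"
      by (simp add: \<xi> d_def \<phi>_def \<eta>_def entry_def)
    ultimately show ?thesis
      by (simp add: norm_mult exp_minus field_simps)
  qed
  then show ?thesis
    using C \<epsilon> by (intro exI[of _ \<epsilon>] subexp_decayI) auto
qed

lemma spectrally_invariant_R_infinity:
  "spectrally_invariant (opers_of (R_infinity l)) (uniform_Roe l)"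
  unfolding spectrally_invariant_def mem_opers_of_iff[of _ "R_infinity l"] Ball_def
proof (intro allI impI)
  fix A B :: "'g oper"
  assume A: "complex_linear A \<and> entry A \<in> R_infinity l"
    and AB: "A o\<^sub>L B = id_blinfun \<and> B o\<^sub>L A = id_blinfun"
  have AB': "A (B \<zeta>) = \<zeta>" and BA': "B (A \<zeta>) = \<zeta>" for \<zeta>
    using AB by (metis blinfun_apply_blinfun_compose id_blinfun.rep_eq)+
  \<comment> \<open>Writing \<open>\<xi>\<close> as \<open>A (B \<xi>)\<close> moves the scalar
    inside \<open>A\<close>, and \<open>B\<close> then cancels \<open>A\<close>.\<close>
  have "B (ell2_scaleC c \<xi>) = ell2_scaleC c (B \<xi>)" for c \<xi>
    using A AB' BA' unfolding complex_linear_def by metis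
  then have "complex_linear B"
    by (simp add: complex_linear_def)
  then show "complex_linear B \<and> entry B \<in> R_infinity l"
    using A AB subexp_decay_inverse unfolding R_infinity_iff by blast
qed

end

end

theorem theorem3p4:
  fixes l :: "'g::{group_add, countable} \<Rightarrow> real"
  assumes "proper_length l"
    and "property_P l"
  shows "(\<forall>t\<in>R_infinity l. \<exists>A. mat_defines t A)
    \<and> unital_subalgebra (opers_of (R_infinity l)) (uniform_Roe l)
    \<and> uniform_Roe l \<subseteq> closure (opers_of (R_infinity l))
    \<and> spectrally_invariant (opers_of (R_infinity l)) (uniform_Roe l)"
proof (intro conjI ballI)
  show "\<exists>A. mat_defines t A" if "t \<in> R_infinity l" for t
    using R_infinity_defines[OF assms that] .
  show "unital_subalgebra (opers_of (R_infinity l)) (uniform_Roe l)"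
    unfolding unital_subalgebra_def
    using algebra_R_infinity[OF assms] opers_R_infinity_subset[OF assms]
      unital_operator_algebra_closure[OF algebra_algebraic_Roe[OF assms(1)]]
    by (simp add: uniform_Roe_def)
  \<comment> \<open>Density holds because the finite propagation matrices, whose operators have
    closure \<open>uniform_Roe l\<close>, already lie in \<open>R_infinity l\<close>.\<close>
  show "uniform_Roe l \<subseteq> closure (opers_of (R_infinity l))"
    unfolding uniform_Roe_def using algebraic_Roe_subset[OF assms]
    by (intro closure_mono) (auto simp: opers_of_def)
  show "spectrally_invariant (opers_of (R_infinity l)) (uniform_Roe l)"
    using spectrally_invariant_R_infinity[OF assms] .
qed

end
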